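(* Let $E$ be a $[\lambda]$-primitive theme of rank $k$ with fundamental invariants $\lambda_1,\dots,\lambda_k$. For any rational number $\delta$ with $\delta>\lambda_k+k-1$, the (a,b)-module $E^*\otimes_{a,b}E_\delta$ is a $[\delta-\lambda]$-primitive theme with fundamental invariants $\delta-\lambda_k,\dots,\delta-\lambda_1$.
   Context: $\tilde{\mathcal A}$ is the $\mathbb C$-algebra of formal series $\sum_{\nu\ge0}P_\nu(a)b^\nu$ ($P_\nu\in\mathbb C[z]$) with product determined by $ab-ba=b^2$ and $b$-adic continuity of multiplication by $a$. An (a,b)-module is a left $\tilde{\mathcal A}$-module free of finite rank over $\mathbb C[[b]]$. Regular: contained in an (a,b)-module $E'$ with $aE'\subset bE'$; its Bernstein polynomial is the minimal polynomial of $-b^{-1}a$ on $E^\sharp/bE^\sharp$, $E^\sharp$ the saturation of $E$ by $b^{-1}a$ in $E[b^{-1}]$. $E_\mu=\mathbb C[[b]]e_\mu$ with $ae_\mu=\mu be_\mu$. A submodule $F\subset E$ is normal if $F\cap bE=bF$. Tensor product: $E\otimes_{a,b}F$ is $E\otimes_{\mathbb C[[b]]}F$ with $a(x\otimes y)=ax\otimes y+x\otimes ay$. Dual: $E^*=\mathrm{Hom}_{\mathbb C[[b]]}(E,E_0)$ with $(a\varphi)(x)=a(\varphi(x))-\varphi(ax)$, where $E_0=\mathbb C[[b]]e_0$, $ae_0=0$. For rational $\lambda\in]0,1]$, $\Xi_\lambda=\bigoplus_{j\ge0}\mathbb C[[b]]e_{\lambda,j}$ (finite sums; $e_{\lambda,j}$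 stands for $s^{\lambda-1}(\log s)^j/j!$), $ae_{\lambda,0}=\lambda be_{\lambda,0}$, $ae_{\lambda,j}=\lambda be_{\lambda,j}+be_{\lambda,j-1}$, extended by $aS(b)=S(b)a+b^2S'(b)$; $\Xi=\bigoplus_{\lambda\in\mathbb Q\cap]0,1]}\Xi_\lambda$. A theme is a left $\tilde{\mathcal A}$-module isomorphic to $\tilde{\mathcal A}\varphi\subset\Xi$, $\varphi\in\Xi$. A regular (a,b)-module is $[\lambda]$-primitive if every root of its Bernstein polynomial lies in $-\lambda+\mathbb Z$. A $[\lambda]$-primitive theme $E$ of rank $k$ has, for each $j\in[0,k]$, exactly one normal submodule $F_j$ of rank $j$, with $F_0\subset F_1\subset\dots\subset F_k=E$ and $F_j/F_{j-1}\cong E_{\lambda_j}$, $\lambda_j\in\lambda+\mathbb Z$ rational; the ordered sequence $\lambda_1,\dots,\lambda_k$ is called the fundamental invariants of $E$. *)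

theory Defs
  imports Complex_Main "HOL-Computational_Algebra.Computational_Algebra"
begin

text \<open>An (a,b)-module is free of finite rank n over C[[b]]; choosing a basis e_0,...,e_(n-1)
 it is described by the matrix M with a e_i = sum_j M i j e_j.  The action of a on a general
 element is forced by the relation a S(b) = S(b) a + b^2 S'(b).  Elements are coefficient
 vectors x :: nat => complex fps with x i = 0 for i >= n.\<close>

type_synonym abmod = "nat \<times> (nat \<Rightarrow> nat \<Rightarrow> complex fps)"
type_synonym abvec = "nat \<Rightarrow> complex fps"

definition rk :: "abmod \<Rightarrow> nat" where "rk E = fst E"
definition mat :: "abmod \<Rightarrow> nat \<Rightarrow> nat \<Rightarrow> complex fps" where "mat E = snd E"

definition vecs :: "abmod \<Rightarrow> abvec set" where
  "vecs E = {x. \<forall>i. rk E \<le> i \<longrightarrow> x i = 0}"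

definition vadd :: "abvec \<Rightarrow> abvec \<Rightarrow> abvec" where "vadd x y = (\<lambda>i. x i + y i)"
definition vsmult :: "complex fps \<Rightarrow> abvec \<Rightarrow> abvec" where "vsmult S x = (\<lambda>i. S * x i)"

definition aop :: "abmod \<Rightarrow> abvec \<Rightarrow> abvec" where
  "aop E x = (\<lambda>j. if j < rk E then (\<Sum>i<rk E. x i * mat E i j) + fps_X ^ 2 * fps_deriv (x j) else 0)"

definition Emod :: "rat \<Rightarrow> abmod" where
  "Emod \<mu> = (1, (\<lambda>i j. fps_const (of_rat \<mu>) * fps_X))"

text \<open>Dual E^* = Hom(E, E_0), in the dual basis: (a phi)(x) = a(phi x) - phi(a x)
  gives a e_i^* = - sum_k M k i e_k^*.\<close>
definition dual :: "abmod \<Rightarrow> abmod" where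
  "dual E = (rk E, (\<lambda>i j. - mat E j i))"

text \<open>Tensor product over C[[b]], basis e_i (x) f_j indexed by i * rk F + j, with
  a(x (x) y) = ax (x) y + x (x) ay.\<close>
definition tensor :: "abmod \<Rightarrow> abmod \<Rightarrow> abmod" where
  "tensor E F = (rk E * rk F, (\<lambda>p q.
     (if p mod rk F = q mod rk F then mat E (p div rk F) (q div rk F) else 0)
   + (if p div rk F = q div rk F then mat F (p mod rk F) (q mod rk F) else 0)))"

definition submod :: "abmod \<Rightarrow> abvec set \<Rightarrow> bool" where
  "submod E F \<longleftrightarrow> F \<subseteq> vecs E \<and> (\<lambda>i. 0) \<in> F
     \<and> (\<forall>x\<in>F. \<forall>y\<in>F. vadd x y \<in> F) \<and> (\<forall>S. \<forall>x\<in>F. vsmult S x \<in> F)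
     \<and> (\<forall>x\<in>F. aop E x \<in> F)"

definition normal_sub :: "abmod \<Rightarrow> abvec set \<Rightarrow> bool" where
  "normal_sub E F \<longleftrightarrow> submod E F \<and> F \<inter> vsmult fps_X ` vecs E = vsmult fps_X ` F"

definition free_rank :: "abvec set \<Rightarrow> nat \<Rightarrow> bool" where
  "free_rank F r \<longleftrightarrow> (\<exists>v :: nat \<Rightarrow> abvec. (\<forall>i<r. v i \<in> F) \<and>
     (\<forall>y\<in>F. \<exists>!c :: nat \<Rightarrow> complex fps. (\<forall>i\<ge>r. c i = 0) \<and>
          y = (\<lambda>k. \<Sum>i<r. c i * v i k)))"

text \<open>G/F is isomorphic to E_mu (F \<subseteq> G submodules of E): there is x in G whose class
  generates G/F freely over C[[b]] and satisfies a x = mu b x mod F.\<close>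
definition quot_iso_E :: "abmod \<Rightarrow> abvec set \<Rightarrow> abvec set \<Rightarrow> rat \<Rightarrow> bool" where
  "quot_iso_E E G F \<mu> \<longleftrightarrow> (\<exists>x\<in>G.
      (\<forall>y\<in>G. \<exists>!S. (\<lambda>i. y i - S * x i) \<in> F)
    \<and> (\<lambda>i. aop E x i - fps_const (of_rat \<mu>) * fps_X * x i) \<in> F)"

definition fund_invs :: "abmod \<Rightarrow> rat list \<Rightarrow> bool" where
  "fund_invs E ls \<longleftrightarrow> length ls = rk E \<and>
    (\<exists>F :: nat \<Rightarrow> abvec set.
       (\<forall>j\<le>rk E. normal_sub E (F j) \<and> free_rank (F j) j)
     \<and> F (rk E) = vecs E
     \<and> (\<forall>j\<in>{1..rk E}. F (j - 1) \<subseteq> F j \<and> quot_iso_E E (F j) (F (j - 1)) (ls ! (j - 1))))"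

definition ab_hom :: "abmod \<Rightarrow> abmod \<Rightarrow> (abvec \<Rightarrow> abvec) \<Rightarrow> bool" where
  "ab_hom E E' g \<longleftrightarrow> (\<forall>x\<in>vecs E. g x \<in> vecs E') \<and>
     (\<forall>x\<in>vecs E. \<forall>y\<in>vecs E. g (vadd x y) = vadd (g x) (g y)) \<and>
     (\<forall>S. \<forall>x\<in>vecs E. g (vsmult S x) = vsmult S (g x)) \<and>
     (\<forall>x\<in>vecs E. g (aop E x) = aop E' (g x))"

definition regular :: "abmod \<Rightarrow> bool" where
  "regular E \<longleftrightarrow> (\<exists>E' g. ab_hom E E' g \<and> inj_on g (vecs E) \<and>
      (\<forall>y\<in>vecs E'. \<exists>z\<in>vecs E'. aop E' y = vsmult fps_X z))"

type_synonym lvec = "nat \<Rightarrow> complex fls"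

text \<open>E[b^-1]: vectors of Laurent series; a extends by a S = S a + b^2 S'.\<close>
definition aopL :: "abmod \<Rightarrow> lvec \<Rightarrow> lvec" where
  "aopL E y = (\<lambda>j. if j < rk E then (\<Sum>i<rk E. y i * fps_to_fls (mat E i j))
                                   + fls_X ^ 2 * fls_deriv (y j) else 0)"

definition binv_a :: "abmod \<Rightarrow> lvec \<Rightarrow> lvec" where
  "binv_a E y = (\<lambda>j. fls_X_inv * aopL E y j)"

inductive_set sat :: "abmod \<Rightarrow> lvec set" for E where
  emb: "x \<in> vecs E \<Longrightarrow> (\<lambda>i. fps_to_fls (x i)) \<in> sat E"
| add: "y \<in> sat E \<Longrightarrow> z \<in> sat E \<Longrightarrow> (\<lambda>i. y i + z i) \<in> sat E"
| smult: "y \<in> sat E \<Longrightarrow> (\<lambda>i. fps_to_fls S * y i) \<in> sat E"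
| ba: "y \<in> sat E \<Longrightarrow> binv_a E y \<in> sat E"

definition poly_op :: "abmod \<Rightarrow> complex poly \<Rightarrow> lvec \<Rightarrow> lvec" where
  "poly_op E p y = (\<lambda>k. \<Sum>i\<le>degree p.
      fls_const (coeff p i) * (((\<lambda>z j. - binv_a E z j) ^^ i) y) k)"

definition annihilates :: "abmod \<Rightarrow> complex poly \<Rightarrow> bool" where
  "annihilates E p \<longleftrightarrow> (\<forall>y\<in>sat E. \<exists>z\<in>sat E. poly_op E p y = (\<lambda>k. fls_X * z k))"

text \<open>Bernstein polynomial: minimal polynomial of -b^-1 a on E^#/bE^#.\<close>
definition is_bernstein :: "abmod \<Rightarrow> complex poly \<Rightarrow> bool" where
  "is_bernstein E p \<longleftrightarrow> lead_coeff p = 1 \<and> annihilates E p \<and>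
     (\<forall>q. lead_coeff q = 1 \<and> annihilates E q \<longrightarrow> degree p \<le> degree q)"

definition primitive :: "abmod \<Rightarrow> rat \<Rightarrow> bool" where
  "primitive E lam \<longleftrightarrow> regular E \<and>
     (\<forall>p. is_bernstein E p \<longrightarrow> (\<forall>z. poly p z = 0 \<longrightarrow>
         (\<exists>m::int. z = of_rat (- lam) + of_int m)))"

text \<open>Elements of Xi: f l j is the coefficient of e_(l,j); finite support, l in ]0,1].\<close>
type_synonym xivec = "rat \<Rightarrow> nat \<Rightarrow> complex fps"

definition Xi :: "xivec set" where
  "Xi = {f. finite {(l, j). f l j \<noteq> 0} \<and> (\<forall>l j. f l j \<noteq> 0 \<longrightarrow> 0 < l \<and> l \<le> 1)}"

text \<open>a(S e_(l,j)) = S (l b e_(l,j) + b e_(l,j-1)) + b^2 S' e_(l,j).\<close>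
definition aXi :: "xivec \<Rightarrow> xivec" where
  "aXi f = (\<lambda>l j. fps_const (of_rat l) * fps_X * f l j + fps_X * f l (Suc j)
                 + fps_X ^ 2 * fps_deriv (f l j))"

inductive_set gen :: "xivec \<Rightarrow> xivec set" for \<phi> where
  base: "\<phi> \<in> gen \<phi>"
| add: "f \<in> gen \<phi> \<Longrightarrow> g \<in> gen \<phi> \<Longrightarrow> (\<lambda>l j. f l j + g l j) \<in> gen \<phi>"
| smult: "f \<in> gen \<phi> \<Longrightarrow> (\<lambda>l j. S * f l j) \<in> gen \<phi>"
| aop: "f \<in> gen \<phi> \<Longrightarrow> aXi f \<in> gen \<phi>"

definition theme :: "abmod \<Rightarrow> bool" where
  "theme E \<longleftrightarrow> (\<exists>\<phi>\<in>Xi. \<exists>g. bij_betw g (vecs E) (gen \<phi>) \<and>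
     (\<forall>x\<in>vecs E. \<forall>y\<in>vecs E. g (vadd x y) = (\<lambda>l j. g x l j + g y l j)) \<and>
     (\<forall>S. \<forall>x\<in>vecs E. g (vsmult S x) = (\<lambda>l j. S * g x l j)) \<and>
     (\<forall>x\<in>vecs E. g (aop E x) = aXi (g x)))"

end

theory Submission
  imports Defs
begin

text \<open>
  A normal flag with rank one quotients gives a basis in which \<open>a\<close> is triangular with diagonal
  \<open>\<lambda>\<^sub>j b\<close>.  For such a module with all \<open>\<lambda>\<^sub>j\<close> in one class modulo \<open>\<int>\<close>, being a theme is visible on the
  subdiagonal entries \<open>T\<^sub>j\<close> alone: the module is generated by one element iff every \<open>T\<^sub>j(0)\<close> is
  nonzero, and a homomorphism to \<open>\<Xi>\<close> that is nonzero on the first basis vector sends the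
  \<open>j\<close>-th one to an element of exact degree \<open>j - 1\<close> in \<open>log s\<close> (so that it is injective) iff each
  \<open>\<lambda>\<^sub>j\<^sub>+\<^sub>1 - \<lambda>\<^sub>j + 1\<close> is a natural number and the coefficient of \<open>T\<^sub>j\<close> in that degree is nonzero.
  Such a homomorphism can be solved for recursively as soon as \<open>\<lambda>\<^sub>1 > k - 1\<close>.  In the reversed dual
  basis the subdiagonal entries of \<open>E\<^sup>* \<otimes> E\<^sub>\<delta>\<close> are those of \<open>E\<close> up to sign and in reverse order,
  with the same exponents, so both conditions pass to the dual; the assumption on \<open>\<delta>\<close> is
  the condition on the first invariant.
\<close>

section \<open>Base change\<close>

text \<open>Being a theme is not visibly self-dual: it asks for an embedding into \<open>Xi\<close>,
  and dualizing turns submodules into quotients. Hence the detour through conditions on a matrix,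
  which survive transposition. The exponent
  \<open>\<lambda>\<^sub>j\<^sub>+\<^sub>1 - \<lambda>\<^sub>j + 1\<close> comes from a resonance.
  Let \<open>l0\<close> in ]0,1] represent the common class. The coefficient of the highest power of
  the logarithm in the image of a basis vector with invariant \<mu> is a monomial in b of degree N
  with \<mu> = l0 + N. If the next vector has degree N', comparing coefficients of b^(N'+1) in its
  equation pairs b^N with the coefficient of the subdiagonal entry in degree N' + 1 - N, which is
  that exponent. The Bernstein polynomial has to be linked with the diagonal in both directions, and
  it is never computed: a multiple with visible roots shows that the dual is primitive, and a lowest
  order element of the saturation shows that all \<lambda>'s of a primitive module lie in one
  class.\<close>

definition mmul :: "nat \<Rightarrow> (nat \<Rightarrow> nat \<Rightarrow> 'a::comm_ring_1) \<Rightarrow> (nat \<Rightarrow> nat \<Rightarrow> 'a) \<Rightarrow> nat \<Rightarrow> nat \<Rightarrow> 'a" where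
  "mmul k A B = (\<lambda>i j. \<Sum>l<k. A i l * B l j)"

lemma mmul_assoc: "mmul k (mmul k A B) C = mmul k A (mmul k B C)"
proof (intro ext)
  fix i j
  have "mmul k (mmul k A B) C i j = (\<Sum>l<k. \<Sum>m<k. A i m * B m l * C l j)"
    by (simp add: mmul_def sum_distrib_right)
  also have "\<dots> = (\<Sum>m<k. \<Sum>l<k. A i m * B m l * C l j)" by (rule sum.swap)
  also have "\<dots> = mmul k A (mmul k B C) i j"
    by (simp add: mmul_def sum_distrib_left mult.assoc)
  finally show "mmul k (mmul k A B) C i j = mmul k A (mmul k B C) i j" .
qed

text \<open>Matrices are total functions with arbitrary values outside the k by k block, so the
  identity can be required on the block only; the bounds on indices in the cancellation rules come
  from this.\<close>

definition inverse_mats :: "nat \<Rightarrow> (nat \<Rightarrow> nat \<Rightarrow> 'a::comm_ring_1) \<Rightarrow> (nat \<Rightarrow> nat \<Rightarrow> 'a) \<Rightarrow> bool" where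
  "inverse_mats k A B \<longleftrightarrow> (\<forall>i<k. \<forall>j<k. mmul k A B i j = (if i = j then 1 else 0))
     \<and> (\<forall>i<k. \<forall>j<k. mmul k B A i j = (if i = j then 1 else 0))"

lemma mmul_cancel_left:
  assumes "inverse_mats k A B" "i < k"
  shows "mmul k A (mmul k B C) i j = C i j"
proof -
  have "mmul k A (mmul k B C) i j = (\<Sum>l<k. mmul k A B i l * C l j)"
    by (simp add: mmul_assoc[symmetric]) (simp add: mmul_def)
  also have "\<dots> = (\<Sum>l<k. if l = i then C l j else 0)"
    using assms by (intro sum.cong) (auto simp: inverse_mats_def)
  also have "\<dots> = C i j" using assms(2) by simp
  finally show ?thesis .
qed

lemma mmul_cancel_right:
  assumes "inverse_mats k A B" "j < k"
  shows "mmul k (mmul k C A) B i j = C i j"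
proof -
  have "mmul k (mmul k C A) B i j = (\<Sum>l<k. C i l * mmul k A B l j)"
    by (simp add: mmul_assoc) (simp add: mmul_def)
  also have "\<dots> = (\<Sum>l<k. if l = j then C i l else 0)"
    using assms by (intro sum.cong) (auto simp: inverse_mats_def)
  also have "\<dots> = C i j" using assms(2) by simp
  finally show ?thesis .
qed

lemma inverse_mats_sym: "inverse_mats k A B \<Longrightarrow> inverse_mats k B A"
  by (simp add: inverse_mats_def)

text \<open>The rows of \<open>X\<close> are the vectors of a new basis of \<open>E\<close>, in which \<open>E\<close> becomes \<open>E'\<close>;
  \<open>C\<close> is the inverse of \<open>X\<close>.\<close>
definition base_change :: "abmod \<Rightarrow> abmod \<Rightarrow> (nat \<Rightarrow> nat \<Rightarrow> complex fps) \<Rightarrow> (nat \<Rightarrow> nat \<Rightarrow> complex fps) \<Rightarrow> bool" where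
  "base_change E E' X C \<longleftrightarrow> rk E' = rk E \<and> inverse_mats (rk E) X C \<and>
     (\<forall>i<rk E. \<forall>j<rk E. mmul (rk E) X (mat E) i j + fps_X ^ 2 * fps_deriv (X i j)
        = mmul (rk E) (mat E') X i j)"

lemma mmul_cong:
  "(\<And>l. l < k \<Longrightarrow> A i l = A' i l) \<Longrightarrow> (\<And>l. l < k \<Longrightarrow> B l j = B' l j) \<Longrightarrow> mmul k A B i j = mmul k A' B' i j"
  by (simp add: mmul_def)

lemma mmul_add_right: "mmul k A (\<lambda>i j. B i j + C i j) i j = mmul k A B i j + mmul k A C i j"
  by (simp add: mmul_def algebra_simps sum.distrib)

lemma mmul_scale_right: "mmul k A (\<lambda>i j. s * B i j) i j = s * mmul k A B i j"
  by (simp add: mmul_def sum_distrib_left algebra_simps)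

lemma fps_deriv_mmul:
  "fps_deriv (mmul k A B i j) = mmul k (\<lambda>i j. fps_deriv (A i j)) B i j + mmul k A (\<lambda>i j. fps_deriv (B i j)) i j"
  by (simp add: mmul_def fps_deriv_sum sum.distrib[symmetric] add.commute)

text \<open>Differentiating \<open>X C = 1\<close> gives \<open>X' C = - X C'\<close>; multiplying
  by \<open>C\<close> on the left isolates \<open>C'\<close>.\<close>

lemma deriv_inverse_mats:
  fixes X :: "nat \<Rightarrow> nat \<Rightarrow> complex fps"
  assumes "inverse_mats k X C" "i < k" "j < k"
  shows "mmul k C (mmul k (\<lambda>i j. fps_deriv (X i j)) C) i j = - fps_deriv (C i j)"
proof -
  have *: "mmul k (\<lambda>i j. fps_deriv (X i j)) C l j = - mmul k X (\<lambda>i j. fps_deriv (C i j)) l j" if "l < k" for l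
  proof -
    have "mmul k X C l j = (if l = j then 1 else 0)" using assms that by (simp add: inverse_mats_def)
    hence "fps_deriv (mmul k X C l j) = 0" by simp
    thus ?thesis by (simp add: fps_deriv_mmul eq_neg_iff_add_eq_0)
  qed
  have "mmul k C (mmul k (\<lambda>i j. fps_deriv (X i j)) C) i j
      = mmul k C (\<lambda>i j. (-1) * mmul k X (\<lambda>i j. fps_deriv (C i j)) i j) i j"
    by (rule mmul_cong) (simp_all add: *)
  also have "\<dots> = - mmul k C (mmul k X (\<lambda>i j. fps_deriv (C i j))) i j"
    by (subst mmul_scale_right) simp
  also have "\<dots> = - fps_deriv (C i j)"
    using mmul_cancel_left[OF inverse_mats_sym[OF assms(1)] assms(2)] by simp
  finally show ?thesis .
qed

text \<open>The base change equation is multiplied by \<open>C\<close> on both sides. The outcome is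
  the equation for the opposite direction and, transposed, the one that the dual basis
  satisfies.\<close>

lemma base_change_swap:
  assumes "base_change E E' X C" "i < rk E" "j < rk E"
  shows "mmul (rk E) (mat E) C i j = mmul (rk E) C (mat E') i j + fps_X ^ 2 * fps_deriv (C i j)"
proof -
  define k where "k = rk E"
  let ?D = "\<lambda>i j. fps_deriv (X i j)"
  have inv: "inverse_mats k X C" and
    eq: "\<And>i j. i < k \<Longrightarrow> j < k \<Longrightarrow> mmul k X (mat E) i j + fps_X ^ 2 * ?D i j = mmul k (mat E') X i j"
    using assms(1) by (auto simp: base_change_def k_def)
  have ij: "i < k" "j < k" using assms(2,3) by (auto simp: k_def)
  have "mmul k C (mmul k (\<lambda>i j. mmul k X (mat E) i j + fps_X ^ 2 * ?D i j) C) i j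
      = mmul k C (mmul k (mmul k (mat E') X) C) i j"
    by (intro mmul_cong refl) (simp add: eq)
  also have "\<dots> = mmul k C (mat E') i j"
    by (intro mmul_cong refl mmul_cancel_right inv ij)
  also have "mmul k C (mmul k (\<lambda>i j. mmul k X (mat E) i j + fps_X ^ 2 * ?D i j) C) i j
      = mmul k C (\<lambda>i j. mmul k (mmul k X (mat E)) C i j + fps_X ^ 2 * mmul k ?D C i j) i j"
    by (intro mmul_cong refl) (simp add: mmul_def algebra_simps sum.distrib sum_distrib_left)
  also have "\<dots> = mmul k C (mmul k X (mmul k (mat E) C)) i j + fps_X ^ 2 * mmul k C (mmul k ?D C) i j"
    by (simp add: mmul_add_right mmul_scale_right mmul_assoc)
  also have "\<dots> = mmul k (mat E) C i j - fps_X ^ 2 * fps_deriv (C i j)"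
    by (simp add: mmul_cancel_left[OF inverse_mats_sym[OF inv] ij(1)] deriv_inverse_mats[OF inv ij])
  finally show ?thesis unfolding k_def by (simp add: algebra_simps)
qed

lemma base_change_sym: "base_change E E' X C \<Longrightarrow> base_change E' E C X"
  using base_change_swap[of E E' X C] by (auto simp: base_change_def inverse_mats_sym)

section \<open>Isomorphisms given by a base change, and what they transport\<close>

definition vmap :: "nat \<Rightarrow> (nat \<Rightarrow> nat \<Rightarrow> complex fps) \<Rightarrow> abvec \<Rightarrow> abvec" where
  "vmap k X x = (\<lambda>j. if j < k then \<Sum>i<k. x i * X i j else 0)"

definition ab_iso :: "abmod \<Rightarrow> abmod \<Rightarrow> (abvec \<Rightarrow> abvec) \<Rightarrow> bool" where
  "ab_iso E E' f \<longleftrightarrow> ab_hom E E' f \<and> bij_betw f (vecs E) (vecs E')"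

lemma aop_vmap:
  assumes "base_change E E' X C"
  shows "aop E (vmap (rk E) X x) = vmap (rk E) X (aop E' x)"
proof
  fix j
  define k where "k = rk E"
  have rk: "rk E = k" "rk E' = k" and
    eq: "\<And>i j. i < k \<Longrightarrow> j < k \<Longrightarrow> (\<Sum>l<k. X i l * mat E l j) + fps_X ^ 2 * fps_deriv (X i j) = (\<Sum>l<k. mat E' i l * X l j)"
    using assms by (auto simp: base_change_def k_def mmul_def)
  show "aop E (vmap (rk E) X x) j = vmap (rk E) X (aop E' x) j"
  proof (cases "j < k")
    case True
    have "aop E (vmap k X x) j = (\<Sum>i<k. \<Sum>l<k. x l * (X l i * mat E i j)) + fps_X^2 * (\<Sum>l<k. x l * fps_deriv (X l j) + fps_deriv (x l) * X l j)"
      using True by (simp add: aop_def vmap_def rk fps_deriv_sum sum_distrib_right mult.assoc)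
    also have "(\<Sum>i<k. \<Sum>l<k. x l * (X l i * mat E i j)) = (\<Sum>l<k. x l * (\<Sum>i<k. X l i * mat E i j))"
      by (subst sum.swap) (simp add: sum_distrib_left)
    also have "\<dots> + fps_X^2 * (\<Sum>l<k. x l * fps_deriv (X l j) + fps_deriv (x l) * X l j)
       = (\<Sum>l<k. x l * ((\<Sum>i<k. X l i * mat E i j) + fps_X^2 * fps_deriv (X l j))) + (\<Sum>l<k. fps_X^2 * fps_deriv (x l) * X l j)"
      by (simp add: sum_distrib_left sum.distrib algebra_simps)
    also have "(\<Sum>l<k. x l * ((\<Sum>i<k. X l i * mat E i j) + fps_X^2 * fps_deriv (X l j))) = (\<Sum>l<k. x l * (\<Sum>i<k. mat E' l i * X i j))"
      using eq True by simp
    also have "\<dots> = (\<Sum>i<k. (\<Sum>l<k. x l * mat E' l i) * X i j)"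
      by (simp add: sum_distrib_left sum_distrib_right mult.assoc) (rule sum.swap)
    also have "\<dots> + (\<Sum>l<k. fps_X^2 * fps_deriv (x l) * X l j) = vmap k X (aop E' x) j"
      using True by (simp add: aop_def vmap_def rk sum.distrib algebra_simps)
    finally show ?thesis by (simp add: k_def)
  qed (simp add: aop_def vmap_def rk)
qed

lemma vmap_inverse:
  assumes "inverse_mats k X C" "\<And>i. k \<le> i \<Longrightarrow> x i = 0"
  shows "vmap k C (vmap k X x) = x"
proof
  fix j
  show "vmap k C (vmap k X x) j = x j"
  proof (cases "j < k")
    case True
    have "vmap k C (vmap k X x) j = mmul k (mmul k (\<lambda>_. x) X) C 0 j"
      using True by (simp add: vmap_def mmul_def)
    thus ?thesis using mmul_cancel_right[OF assms(1) True, of "\<lambda>_. x" 0] by simp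
  qed (simp add: vmap_def assms(2))
qed

text \<open>Coordinates are row vectors, so multiplying by \<open>X\<close> turns coordinates in the
  new basis into old ones: the map goes from \<open>E'\<close> to \<open>E\<close>.\<close>

lemma ab_iso_vmap:
  assumes "base_change E E' X C"
  shows "ab_iso E' E (vmap (rk E) X)"
  unfolding ab_iso_def
proof
  have rk: "rk E' = rk E" and inv: "inverse_mats (rk E) X C"
    using assms by (auto simp: base_change_def)
  show "ab_hom E' E (vmap (rk E) X)"
    unfolding ab_hom_def using aop_vmap[OF assms]
    by (auto simp: vecs_def vmap_def vadd_def vsmult_def sum.distrib sum_distrib_left algebra_simps)
  show "bij_betw (vmap (rk E) X) (vecs E') (vecs E)"
    by (rule bij_betw_byWitness[where f' = "vmap (rk E) C"])
       (auto simp: vecs_def rk intro!: vmap_inverse inv inverse_mats_sym[OF inv], auto simp: vmap_def)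
qed

lemma ab_homD:
  assumes "ab_hom E E' f" "x \<in> vecs E"
  shows "f x \<in> vecs E'" "y \<in> vecs E \<Longrightarrow> f (vadd x y) = vadd (f x) (f y)"
    "f (vsmult S x) = vsmult S (f x)" "f (aop E x) = aop E' (f x)"
  using assms unfolding ab_hom_def by blast+

lemma ab_hom_sum:
  assumes "ab_hom E E' f" "\<And>i. i < n \<Longrightarrow> v i \<in> vecs E"
  shows "f (\<lambda>k. \<Sum>i<n. c i * v i k) = (\<lambda>k. \<Sum>i<(n::nat). c i * f (v i) k)"
  using assms(2)
proof (induction n)
  case 0
  have "f (vsmult 0 (\<lambda>_. 0)) = vsmult 0 (f (\<lambda>_. 0))"
    using assms(1) by (simp add: ab_hom_def vecs_def)
  thus ?case by (simp add: vsmult_def)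
next
  case (Suc n)
  have *: "(\<lambda>k. \<Sum>i<n. c i * v i k) \<in> vecs E" "vsmult (c n) (v n) \<in> vecs E" "v n \<in> vecs E"
    using Suc.prems by (auto simp: vecs_def vsmult_def)
  have "f (vadd (\<lambda>k. \<Sum>i<n. c i * v i k) (vsmult (c n) (v n)))
     = vadd (f (\<lambda>k. \<Sum>i<n. c i * v i k)) (vsmult (c n) (f (v n)))"
    by (simp add: ab_homD[OF assms(1)] *)
  thus ?case using Suc by (simp add: vadd_def vsmult_def)
qed

lemma ab_hom_diff:
  assumes "ab_hom E E' f" "x \<in> vecs E" "y \<in> vecs E"
  shows "f (\<lambda>i. x i - S * y i) = (\<lambda>i. f x i - S * f y i)"
  using ab_hom_sum[OF assms(1), of 2 "\<lambda>i. if i = 0 then x else y" "\<lambda>i. if i = 0 then 1 else - S"] assms(2,3)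
  by (auto simp: numeral_2_eq_2)

lemma submod_image:
  assumes "ab_iso E E' f" "submod E F"
  shows "submod E' (f ` F)"
proof -
  have h: "ab_hom E E' f" and b: "bij_betw f (vecs E) (vecs E')" using assms(1) by (auto simp: ab_iso_def)
  have F: "F \<subseteq> vecs E" using assms(2) by (simp add: submod_def)
  have "f (\<lambda>i. 0) = (\<lambda>i. 0)" using ab_hom_sum[OF h, of 0 undefined undefined] by simp
  hence "(\<lambda>i. 0) \<in> f ` F" using assms(2) by (metis imageI submod_def)
  moreover have "f ` F \<subseteq> vecs E'" using F b by (auto simp: bij_betw_def)
  moreover have "vadd (f x) (f y) = f (vadd x y)" "vsmult S (f x) = f (vsmult S x)" "aop E' (f x) = f (aop E x)"
    if "x \<in> F" "y \<in> F" for x y S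
    using that F by (auto simp: ab_homD[OF h] subset_iff)
  ultimately show ?thesis
    using assms(2) unfolding submod_def by auto
qed

lemma normal_sub_image:
  assumes "ab_iso E E' f" "normal_sub E F"
  shows "normal_sub E' (f ` F)"
proof -
  have h: "ab_hom E E' f" and b: "bij_betw f (vecs E) (vecs E')" using assms(1) by (auto simp: ab_iso_def)
  have F: "F \<subseteq> vecs E" "submod E F" and n: "F \<inter> vsmult fps_X ` vecs E = vsmult fps_X ` F"
    using assms(2) by (simp_all add: submod_def normal_sub_def)
  have sm: "f (vsmult fps_X x) = vsmult fps_X (f x)" if "x \<in> vecs E" for x
    using h that by (simp add: ab_hom_def)
  have v: "vsmult fps_X ` vecs E \<subseteq> vecs E" by (auto simp: vecs_def vsmult_def)
  have img: "vsmult fps_X ` f ` A = f ` vsmult fps_X ` A" if "A \<subseteq> vecs E" for A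
    unfolding image_image using sm that by (intro image_cong) auto
  have "vsmult fps_X ` vecs E' = f ` vsmult fps_X ` vecs E"
    using b img[of "vecs E"] by (simp add: bij_betw_def)
  moreover note img[OF F(1)]
  moreover have "f ` F \<inter> f ` vsmult fps_X ` vecs E = f ` (F \<inter> vsmult fps_X ` vecs E)"
    using b F(1) v by (intro inj_on_image_Int[symmetric]) (auto simp: bij_betw_def)
  ultimately show ?thesis using submod_image[OF assms(1) F(2)] n by (simp add: normal_sub_def)
qed

lemma free_rank_image:
  assumes "ab_iso E E' f" "F \<subseteq> vecs E" "free_rank F r"
  shows "free_rank (f ` F) r"
proof -
  have h: "ab_hom E E' f" and b: "bij_betw f (vecs E) (vecs E')" using assms(1) by (auto simp: ab_iso_def)
  from assms(3) obtain v where v: "\<forall>i<r. v i \<in> F" and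
    u: "\<forall>y\<in>F. \<exists>!c :: nat \<Rightarrow> complex fps. (\<forall>i\<ge>r. c i = 0) \<and> y = (\<lambda>k. \<Sum>i<r. c i * v i k)"
    unfolding free_rank_def by (elim exE conjE)
  have s: "(\<lambda>k. \<Sum>i<r. c i * f (v i) k) = f (\<lambda>k. \<Sum>i<r. c i * v i k)" for c
    using ab_hom_sum[OF h, of r v c] v assms(2) by (metis subsetD)
  have in_v: "(\<lambda>k. \<Sum>i<r. c i * v i k) \<in> vecs E" for c
    using v assms(2) by (auto simp: vecs_def subset_iff intro!: sum.neutral)
  have e: "f y = (\<lambda>k. \<Sum>i<r. c i * f (v i) k) \<longleftrightarrow> y = (\<lambda>k. \<Sum>i<r. c i * v i k)" if "y \<in> F" for y c
    unfolding s using b in_v[of c] that assms(2) by (auto simp: bij_betw_def inj_on_eq_iff subset_iff)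
  show ?thesis unfolding free_rank_def
  proof (intro exI[of _ "\<lambda>i. f (v i)"] conjI ballI)
    show "\<forall>i<r. f (v i) \<in> f ` F" using v by blast
    fix y' assume "y' \<in> f ` F"
    then obtain y where "y \<in> F" "y' = f y" by blast
    thus "\<exists>!c. (\<forall>i\<ge>r. c i = 0) \<and> y' = (\<lambda>k. \<Sum>i<r. c i * f (v i) k)"
      using u by (simp only: e)
  qed
qed

lemma quot_iso_E_image:
  assumes "ab_iso E E' f" "G \<subseteq> vecs E" "F \<subseteq> vecs E" "quot_iso_E E G F \<mu>"
  shows "quot_iso_E E' (f ` G) (f ` F) \<mu>"
proof -
  have h: "ab_hom E E' f" and b: "bij_betw f (vecs E) (vecs E')" using assms(1) by (auto simp: ab_iso_def)
  from assms(4) obtain x where x: "x \<in> G" "\<forall>y\<in>G. \<exists>!S. (\<lambda>i. y i - S * x i) \<in> F"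
      "(\<lambda>i. aop E x i - fps_const (of_rat \<mu>) * fps_X * x i) \<in> F"
    unfolding quot_iso_E_def by (elim bexE conjE)
  have xv: "x \<in> vecs E" "aop E x \<in> vecs E" using x assms(2) by (auto simp: vecs_def aop_def)
  have e: "(\<lambda>i. f y i - S * f x i) \<in> f ` F \<longleftrightarrow> (\<lambda>i. y i - S * x i) \<in> F" if "y \<in> G" for y S
  proof -
    have "y \<in> vecs E" using that assms(2) by auto
    hence "(\<lambda>i. f y i - S * f x i) = f (\<lambda>i. y i - S * x i)" "(\<lambda>i. y i - S * x i) \<in> vecs E"
      using ab_hom_diff[OF h _ xv(1), of y S] xv by (auto simp: vecs_def)
    thus ?thesis using inj_on_image_mem_iff[of f "vecs E" _ F] b assms(3) by (simp add: bij_betw_def)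
  qed
  have "(\<lambda>i. aop E' (f x) i - fps_const (of_rat \<mu>) * fps_X * f x i) \<in> f ` F"
  proof -
    have "aop E' (f x) = f (aop E x)" using h xv by (simp add: ab_hom_def)
    thus ?thesis using ab_hom_diff[OF h xv(2,1), of "fps_const (of_rat \<mu>) * fps_X"] x(3)
      by (metis imageI)
  qed
  moreover have "\<forall>y'\<in>f ` G. \<exists>!S. (\<lambda>i. y' i - S * f x i) \<in> f ` F"
    using x(2) by (simp add: e)
  ultimately show ?thesis unfolding quot_iso_E_def using x(1) by blast
qed

lemma fund_invs_transfer:
  assumes "ab_iso E E' f" "rk E' = rk E" "fund_invs E ls"
  shows "fund_invs E' ls"
proof -
  from assms(3) obtain F where F: "\<forall>j\<le>rk E. normal_sub E (F j) \<and> free_rank (F j) j" "F (rk E) = vecs E"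
      "\<forall>j\<in>{1..rk E}. F (j - 1) \<subseteq> F j \<and> quot_iso_E E (F j) (F (j - 1)) (ls ! (j - 1))"
    and len: "length ls = rk E"
    unfolding fund_invs_def by (elim exE conjE)
  have sub: "F j \<subseteq> vecs E" if "j \<le> rk E" for j
    using F(1) that by (auto simp: normal_sub_def submod_def)
  have "f ` F (rk E) = vecs E'" using assms(1) F(2) by (simp add: ab_iso_def bij_betw_def)
  moreover have "\<forall>j\<le>rk E. normal_sub E' (f ` F j) \<and> free_rank (f ` F j) j"
    using F(1) sub by (blast intro: normal_sub_image[OF assms(1)] free_rank_image[OF assms(1)])
  moreover have "\<forall>j\<in>{1..rk E}. f ` F (j - 1) \<subseteq> f ` F j \<and> quot_iso_E E' (f ` F j) (f ` F (j - 1)) (ls ! (j - 1))"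
    using F(3) sub by (intro ballI conjI image_mono quot_iso_E_image[OF assms(1)] sub) auto
  ultimately show ?thesis unfolding fund_invs_def assms(2) using len
    by (intro conjI exI[of _ "\<lambda>j. f ` F j"]) assumption+
qed

lemma theme_transfer:
  assumes "ab_iso E E' f" "theme E'"
  shows "theme E"
proof -
  have h: "ab_hom E E' f" and b: "bij_betw f (vecs E) (vecs E')" using assms(1) by (auto simp: ab_iso_def)
  obtain \<phi> g where g: "\<phi> \<in> Xi" "bij_betw g (vecs E') (gen \<phi>)"
     "\<forall>x\<in>vecs E'. \<forall>y\<in>vecs E'. g (vadd x y) = (\<lambda>l j. g x l j + g y l j)"
     "\<forall>S. \<forall>x\<in>vecs E'. g (vsmult S x) = (\<lambda>l j. S * g x l j)"
     "\<forall>x\<in>vecs E'. g (aop E' x) = aXi (g x)"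
    using assms(2) unfolding theme_def by blast
  have v: "f x \<in> vecs E'" if "x \<in> vecs E" for x using b that by (auto simp: bij_betw_def)
  show ?thesis unfolding theme_def
    using g h v bij_betw_trans[OF b g(2)]
    by (intro bexI[of _ \<phi>] exI[of _ "g \<circ> f"]) (auto simp: ab_hom_def)
qed

lemma regular_transfer:
  assumes "ab_iso E E' f" "regular E'"
  shows "regular E"
proof -
  have h: "ab_hom E E' f" and b: "bij_betw f (vecs E) (vecs E')" using assms(1) by (auto simp: ab_iso_def)
  obtain E'' g where g: "ab_hom E' E'' g" "inj_on g (vecs E')" and
    s: "\<forall>y\<in>vecs E''. \<exists>z\<in>vecs E''. aop E'' y = vsmult fps_X z"
    using assms(2) unfolding regular_def by blast
  have "ab_hom E E'' (g \<circ> f)" using h g(1) by (auto simp: ab_hom_def)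
  moreover have "inj_on (g \<circ> f) (vecs E)" using b g(2) by (auto simp: bij_betw_def intro: comp_inj_on)
  ultimately show ?thesis using s unfolding regular_def by blast
qed

section \<open>Triangular bases and fundamental invariants\<close>

definition triangular :: "abmod \<Rightarrow> rat list \<Rightarrow> bool" where
  "triangular E ls \<longleftrightarrow> length ls = rk E
     \<and> (\<forall>i<rk E. mat E i i = fps_const (of_rat (ls ! i)) * fps_X)
     \<and> (\<forall>j<rk E. \<forall>i<j. mat E i j = 0)"

lemma triangularD:
  assumes "triangular E ls"
  shows "length ls = rk E" "i < rk E \<Longrightarrow> mat E i i = fps_const (of_rat (ls ! i)) * fps_X"
    "i < j \<Longrightarrow> j < rk E \<Longrightarrow> mat E i j = 0"
  using assms by (auto simp: triangular_def)

definition uvec :: "nat \<Rightarrow> abvec" where "uvec j = (\<lambda>i. if i = j then 1 else 0)"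

lemma aop_triangular:
  assumes "triangular E ls" "\<And>i. m \<le> i \<Longrightarrow> x i = 0" "m \<le> rk E"
  shows "j < rk E \<Longrightarrow> aop E x j = fps_const (of_rat (ls ! j)) * fps_X * x j
      + (\<Sum>i\<in>{j<..<m}. x i * mat E i j) + fps_X ^ 2 * fps_deriv (x j)"
    and "m \<le> j \<Longrightarrow> aop E x j = 0"
proof -
  show *: "aop E x j = fps_const (of_rat (ls ! j)) * fps_X * x j
      + (\<Sum>i\<in>{j<..<m}. x i * mat E i j) + fps_X ^ 2 * fps_deriv (x j)" if "j < rk E" for j
  proof -
    have "(\<Sum>i<rk E. x i * mat E i j) = (\<Sum>i\<in>insert j {j<..<m}. x i * mat E i j)"
      by (rule sum.mono_neutral_right)
         (use that assms in \<open>auto simp: not_less triangularD(3)[OF assms(1)] intro: linorder_cases[of _ j]\<close>)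
    thus ?thesis using that by (simp add: aop_def triangularD(2)[OF assms(1)] mult.commute)
  qed
  show "aop E x j = 0" if "m \<le> j"
    using *[of j] assms(2)[OF that] that by (cases "j < rk E") (auto simp: aop_def)
qed

lemma fund_invs_triangular:
  assumes "triangular E ls"
  shows "fund_invs E ls"
proof -
  define F :: "nat \<Rightarrow> abvec set" where "F = (\<lambda>m. {x. \<forall>i\<ge>m. x i = 0})"
  have sub: "F m \<subseteq> vecs E" if "m \<le> rk E" for m using that by (auto simp: F_def vecs_def)
  have "submod E (F m)" if "m \<le> rk E" for m
    using sub[OF that] that aop_triangular(2)[OF assms]
    by (auto simp: submod_def) (auto simp: F_def vadd_def vsmult_def)
  moreover have "F m \<inter> vsmult fps_X ` vecs E = vsmult fps_X ` F m" if "m \<le> rk E" for m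
    using sub[OF that] by (auto simp: F_def vsmult_def)
  moreover have "free_rank (F m) m" for m
    unfolding free_rank_def
  proof (intro exI[of _ uvec] conjI allI impI ballI)
    show "uvec i \<in> F m" if "i < m" for i using that by (auto simp: F_def uvec_def)
    fix y assume y: "y \<in> F m"
    have *: "(\<Sum>i<m. c i * uvec i k) = (if k < m then c k else 0)" for c :: "nat \<Rightarrow> complex fps" and k
      by (simp add: uvec_def if_distrib[of "(*) _"] cong: if_cong)
    show "\<exists>!c. (\<forall>i\<ge>m. c i = 0) \<and> y = (\<lambda>k. \<Sum>i<m. c i * uvec i k)"
      unfolding * using y by (intro ex1I[of _ y]) (auto simp: F_def fun_eq_iff)
  qed
  moreover have "F (rk E) = vecs E" by (auto simp: F_def vecs_def)
  moreover have "F (j - 1) \<subseteq> F j" for j by (auto simp: F_def)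
  moreover have "quot_iso_E E (F j) (F (j - 1)) (ls ! (j - 1))" if j: "j \<in> {1..rk E}" for j
    unfolding quot_iso_E_def
  proof (intro bexI[of _ "uvec (j - 1)"] conjI ballI)
    show u: "uvec (j - 1) \<in> F j" using j by (auto simp: F_def uvec_def)
    show "\<exists>!S. (\<lambda>i. y i - S * uvec (j - 1) i) \<in> F (j - 1)" if y: "y \<in> F j" for y
    proof (intro ex1I[of _ "y (j - 1)"])
      show "(\<lambda>i. y i - y (j - 1) * uvec (j - 1) i) \<in> F (j - 1)"
        using y by (auto simp: F_def uvec_def)
      show "S = y (j - 1)" if "(\<lambda>i. y i - S * uvec (j - 1) i) \<in> F (j - 1)" for S
        using that by (auto simp: F_def uvec_def dest: spec[of _ "j - 1"])
    qed
    have a: "aop E (uvec (j - 1)) i = fps_const (of_rat (ls ! (j - 1))) * fps_X * uvec (j - 1) i" if "j - 1 \<le> i" for i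
    proof (cases "i = j - 1")
      case True
      hence "{i<..<j} = {}" by auto
      thus ?thesis using aop_triangular(1)[OF assms, of j "uvec (j - 1)" i] True j
        by (auto simp: uvec_def)
    next
      case False
      hence "j \<le> i" using that by auto
      thus ?thesis using aop_triangular(2)[OF assms, of j "uvec (j - 1)" i] j u
        by (auto simp: F_def uvec_def)
    qed
    show "(\<lambda>i. aop E (uvec (j - 1)) i - fps_const (of_rat (ls ! (j - 1))) * fps_X * uvec (j - 1) i) \<in> F (j - 1)"
      unfolding F_def mem_Collect_eq using a by simp
  qed
  ultimately show ?thesis unfolding fund_invs_def normal_sub_def
    using triangularD(1)[OF assms] by (intro conjI exI[of _ F]) auto
qed

text \<open>Lifts \<open>x j\<close> of generators of the successive quotients form a basis adapted
  to the flag. The remainder of \<open>a\<close> on \<open>x j\<close> beyond its diagonal term lies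
  in \<open>F j\<close>; its coordinates \<open>t j\<close> fill the row left of the
  diagonal.\<close>

lemma fund_invs_imp_triangular:
  assumes "fund_invs E ls"
  shows "\<exists>E' X C. base_change E E' X C \<and> triangular E' ls"
proof -
  define k where "k = rk E"
  from assms obtain F where F: "\<forall>j\<le>k. normal_sub E (F j) \<and> free_rank (F j) j" "F k = vecs E"
      "\<forall>j\<in>{1..k}. F (j - 1) \<subseteq> F j \<and> quot_iso_E E (F j) (F (j - 1)) (ls ! (j - 1))"
    and len: "length ls = k"
    unfolding fund_invs_def k_def by (elim exE conjE)
  have sm: "submod E (F j)" if "j \<le> k" for j using F(1) that by (simp add: normal_sub_def)
  have lin: "(\<lambda>q. y q + S * x q) \<in> F j" if "j \<le> k" "x \<in> F j" "y \<in> F j" for x y S j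
    using sm[OF that(1)] that(2,3) by (simp add: submod_def vadd_def vsmult_def)
  have zero: "(\<lambda>q. 0) \<in> F j" if "j \<le> k" for j using sm[OF that] by (simp add: submod_def)
  have mono: "F j \<subseteq> F (Suc j)" if "j < k" for j using F(3) that by (auto dest!: bspec[of _ _ "Suc j"])
  define P where "P = (\<lambda>j x. x \<in> F (Suc j) \<and> (\<forall>y\<in>F (Suc j). \<exists>!S. (\<lambda>i. y i - S * x i) \<in> F j)
      \<and> (\<lambda>i. aop E x i - fps_const (of_rat (ls ! j)) * fps_X * x i) \<in> F j)"
  have "\<forall>j\<in>{..<k}. \<exists>x. P j x"
  proof
    fix j assume "j \<in> {..<k}"
    hence "quot_iso_E E (F (Suc j)) (F j) (ls ! j)" using bspec[OF F(3), of "Suc j"] by simp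
    thus "\<exists>x. P j x" unfolding P_def quot_iso_E_def Bex_def .
  qed
  from bchoice[OF this] obtain x where x': "\<And>j. j < k \<Longrightarrow> P j (x j)" by (metis lessThan_iff)
  have x: "\<And>j. j < k \<Longrightarrow> x j \<in> F (Suc j)"
    "\<And>j y. j < k \<Longrightarrow> y \<in> F (Suc j) \<Longrightarrow> \<exists>!S. (\<lambda>i. y i - S * x j i) \<in> F j"
    "\<And>j. j < k \<Longrightarrow> (\<lambda>i. aop E (x j) i - fps_const (of_rat (ls ! j)) * fps_X * x j i) \<in> F j"
    using x' unfolding P_def by (elim conjE meta_allE meta_impE; blast)+
  have comb: "(\<lambda>q. \<Sum>i<j. c i * x i q) \<in> F j" if "j \<le> k" for j c
    using that
  proof (induction j)
    case (Suc j)
    have "(\<lambda>q. \<Sum>i<j. c i * x i q) \<in> F (Suc j)" using Suc mono[of j] by auto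
    thus ?case using lin[of "Suc j" "x j" _ "c j"] Suc.prems x(1)[of j] by simp
  qed (use zero in simp)
  \<comment> \<open>Freeness of rank 0 writes an element of \<open>F 0\<close> as an empty sum, so
    any family of vectors may stand in it.\<close>
  have F0: "y = (\<lambda>q. 0)" if "y \<in> F 0" for y
  proof -
    have "free_rank (F 0) 0" using F(1) by blast
    from this[unfolded free_rank_def] that have "\<exists>c :: nat \<Rightarrow> complex fps. y = (\<lambda>k. \<Sum>i<0. c i * (undefined :: nat \<Rightarrow> abvec) i k)"
      by auto
    thus ?thesis by simp
  qed
  have span: "\<exists>c. y = (\<lambda>q. \<Sum>i<j. c i * x i q)" if "j \<le> k" "y \<in> F j" for j y
    using that
  proof (induction j arbitrary: y)
    case (Suc j)
    then obtain S where "(\<lambda>i. y i - S * x j i) \<in> F j" using x(2)[of j y] by auto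
    then obtain c where c: "(\<lambda>i. y i - S * x j i) = (\<lambda>q. \<Sum>i<j. c i * x i q)" using Suc by auto
    have "y q = (\<Sum>i<Suc j. (c(j := S)) i * x i q)" for q
      using fun_cong[OF c, of q] by (simp add: algebra_simps)
    thus ?case by blast
  qed (use F0 in simp)
  have indep: "c i = 0" if "j \<le> k" "\<And>q. (\<Sum>i<j. c i * x i q) = 0" "i < j" for i j c
    using that
  proof (induction j arbitrary: i)
    case (Suc j)
    \<comment> \<open>Both \<open>- c j\<close> and \<open>0\<close> turn out to be coordinates of
      the zero vector modulo \<open>F j\<close>, and uniqueness of that coordinate makes
      \<open>c j\<close> vanish.\<close>
    have "(\<lambda>q. 0 - (- c j) * x j q) \<in> F j"
    proof -
      have "(\<lambda>q. 0 - (- c j) * x j q) = (\<lambda>q. \<Sum>i<j. (- c i) * x i q)"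
        using Suc.prems(2) by (auto simp: fun_eq_iff sum_negf eq_neg_iff_add_eq_0 add.commute)
      thus ?thesis using comb[of j "\<lambda>i. - c i"] Suc.prems by simp
    qed
    moreover have "(\<lambda>q. 0 - 0 * x j q) \<in> F j" using zero[of j] Suc.prems by simp
    moreover have "\<exists>!S. (\<lambda>i. 0 - S * x j i) \<in> F j"
      using x(2)[of j "\<lambda>_. 0"] zero[of "Suc j"] Suc.prems(1) by simp
    ultimately have "- c j = 0" using Uniq_D[of "\<lambda>S. (\<lambda>i. 0 - S * x j i) \<in> F j" "- c j" 0]
      by (simp only: ex1_iff_ex_Uniq)
    thus ?case using Suc by (cases "i = j") auto
  qed simp
  have "\<forall>i<k. \<exists>c. uvec i = (\<lambda>q. \<Sum>j<k. c j * x j q)"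
    using span[of k] F(2) by (auto simp: vecs_def uvec_def k_def)
  then obtain C where C: "\<And>i. i < k \<Longrightarrow> uvec i = (\<lambda>q. \<Sum>j<k. C i j * x j q)" by metis
  have xv: "x i q = 0" if "i < k" "k \<le> q" for i q
  proof -
    have "x i \<in> vecs E" using x(1)[OF that(1)] sm[of "Suc i"] that by (auto simp: submod_def)
    thus ?thesis using that by (auto simp: vecs_def k_def)
  qed
  have Cx: "mmul k C x i j = (if i = j then 1 else 0)" if "i < k" for i j
    using fun_cong[OF C[OF that], of j] by (simp add: mmul_def uvec_def eq_commute)
  \<comment> \<open>The relation \<open>C x = 1\<close> gives \<open>x C x = x\<close>, and
    independence of the rows of \<open>x\<close> allows \<open>x\<close> to be cancelled on the
    right.\<close>
  have xC: "mmul k x C l i = (if l = i then 1 else 0)" if "l < k" "i < k" for l i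
  proof -
    have "mmul k (mmul k x C) x l q = x l q" for q
    proof (cases "q < k")
      case True
      have "mmul k x (mmul k C x) l q = mmul k x (\<lambda>i j. if i = j then 1 else 0) l q"
        by (intro mmul_cong) (simp_all add: Cx)
      thus ?thesis using True by (simp add: mmul_assoc) (simp add: mmul_def if_distrib[of "(*) _"] cong: if_cong)
    next
      case False
      thus ?thesis using xv that(1) by (simp add: mmul_def)
    qed
    hence "(\<Sum>i<k. (mmul k x C l i - (if l = i then 1 else 0)) * x i q) = 0" for q
      using that(1) by (simp add: mmul_def[of k "mmul k x C"] left_diff_distrib sum_subtractf if_distrib[of "\<lambda>a. a * _"] cong: if_cong)
    from indep[of k, OF _ this that(2)] show ?thesis by simp
  qed
  have "\<forall>j\<in>{..<k}. \<exists>c. (\<lambda>i. aop E (x j) i - fps_const (of_rat (ls ! j)) * fps_X * x j i) = (\<lambda>q. \<Sum>i<j. c i * x i q)"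
    using x(3) by (auto intro: span)
  from bchoice[OF this] obtain t where
    t: "\<And>j. j < k \<Longrightarrow> (\<lambda>i. aop E (x j) i - fps_const (of_rat (ls ! j)) * fps_X * x j i) = (\<lambda>q. \<Sum>i<j. t j i * x i q)"
    by (auto simp: lessThan_iff)
  define E' :: abmod where "E' = (k, \<lambda>i j. if j < i then t i j else if j = i then fps_const (of_rat (ls ! i)) * fps_X else 0)"
  have "mmul k x (mat E) i j + fps_X ^ 2 * fps_deriv (x i j) = mmul k (mat E') x i j" if "i < k" "j < k" for i j
  proof -
    have "mmul k (mat E') x i j = (\<Sum>l\<in>insert i {..<i}. mat E' i l * x l j)"
      unfolding mmul_def by (rule sum.mono_neutral_right) (use that in \<open>auto simp: E'_def mat_def\<close>)
    also have "\<dots> = fps_const (of_rat (ls ! i)) * fps_X * x i j + (\<Sum>l<i. t i l * x l j)"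
      by (simp add: E'_def mat_def)
    also have "\<dots> = aop E (x i) j" using fun_cong[OF t[OF that(1)], of j] by (simp add: algebra_simps)
    also have "\<dots> = mmul k x (mat E) i j + fps_X ^ 2 * fps_deriv (x i j)"
      using that by (simp add: aop_def mmul_def k_def)
    finally show ?thesis by simp
  qed
  hence "base_change E E' x C"
    unfolding base_change_def inverse_mats_def k_def[symmetric] using Cx xC by (auto simp: E'_def rk_def)
  moreover have "triangular E' ls"
    using len by (auto simp: triangular_def E'_def rk_def mat_def)
  ultimately show ?thesis by blast
qed

section \<open>Saturation and base change\<close>

text \<open>This is the operator whose minimal polynomial defines the Bernstein polynomial. It is
  linear over constants but not over power series, so only constants are moved through it
  below.\<close>

definition zop :: "abmod \<Rightarrow> lvec \<Rightarrow> lvec" where "zop E y = (\<lambda>j. - binv_a E y j)"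

lemma aopL_add: "aopL E (\<lambda>i. y i + z i) = (\<lambda>i. aopL E y i + aopL E z i)"
  by (auto simp: aopL_def algebra_simps sum.distrib)

lemma aopL_const: "aopL E (\<lambda>i. fls_const c * y i) = (\<lambda>i. fls_const c * aopL E y i)"
  by (auto simp: aopL_def algebra_simps sum_distrib_left)

lemma zop_add: "zop E (\<lambda>i. y i + z i) = (\<lambda>i. zop E y i + zop E z i)"
  by (simp add: zop_def binv_a_def aopL_add algebra_simps)

lemma zop_const: "zop E (\<lambda>i. fls_const c * y i) = (\<lambda>i. fls_const c * zop E y i)"
  by (simp add: zop_def binv_a_def aopL_const algebra_simps)

text \<open>A bound \<open>n\<close> replaces the exact degree because \<open>pCons c p\<close> does
  not gain a degree when \<open>p = 0\<close>.\<close>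

lemma poly_op_eq_sum:
  assumes "degree p \<le> n"
  shows "poly_op E p y = (\<lambda>k. \<Sum>i\<le>n. fls_const (coeff p i) * ((zop E ^^ i) y) k)"
proof -
  have "(\<lambda>z j. - binv_a E z j) = zop E" by (simp add: zop_def fun_eq_iff)
  thus ?thesis unfolding poly_op_def
    using assms by (auto intro!: ext sum.mono_neutral_left simp: le_degree)
qed

lemma poly_op_pCons:
  "poly_op E (pCons c p) y = (\<lambda>k. fls_const c * y k + poly_op E p (zop E y) k)"
  unfolding poly_op_eq_sum[OF degree_pCons_le] poly_op_eq_sum[OF order_refl]
  by (simp add: sum.atMost_Suc_shift funpow_swap1 del: sum.atMost_Suc)

lemma poly_op_0 [simp]: "poly_op E 0 y = (\<lambda>_. 0)" by (simp add: poly_op_def)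

lemma poly_op_add: "poly_op E (p + q) y = (\<lambda>i. poly_op E p y i + poly_op E q y i)"
proof (induction p arbitrary: q y)
  case (pCons a p)
  show ?case by (cases q)
    (simp add: pCons.IH poly_op_pCons distrib_right flip: fls_plus_const, simp add: algebra_simps)
qed simp

lemma poly_op_smult: "poly_op E (smult c p) y = (\<lambda>i. fls_const c * poly_op E p y i)"
  by (induction p arbitrary: y) (simp_all add: poly_op_pCons algebra_simps flip: fls_const_mult_const)

lemma poly_op_zop: "poly_op E p (zop E y) = zop E (poly_op E p y)"
proof (induction p arbitrary: y)
  case 0
  have "zop E (\<lambda>i. fls_const 0 * 0) = (\<lambda>i. 0)" by (subst zop_const) simp
  thus ?case by simp
next
  case (pCons a p)
  thus ?case by (simp add: poly_op_pCons zop_add zop_const)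
qed

lemma poly_op_mult: "poly_op E (p * q) y = poly_op E p (poly_op E q y)"
  by (induction p arbitrary: y) (simp_all add: poly_op_pCons poly_op_add poly_op_smult poly_op_zop)

lemma poly_op_prod_lessThan_Suc:
  "poly_op E (\<Prod>i<Suc n. f i) y = poly_op E (\<Prod>i<n. f i) (poly_op E (f n) y)"
  by (simp add: poly_op_mult)

lemma sat_const: "y \<in> sat E \<Longrightarrow> (\<lambda>i. fls_const c * y i) \<in> sat E"
  using sat.smult[of y E "fps_const c"] by simp

lemma sat_zero: "(\<lambda>i. 0) \<in> sat E"
  using sat.emb[of "\<lambda>i. 0" E] by (simp add: vecs_def)

lemma sat_zop: "y \<in> sat E \<Longrightarrow> zop E y \<in> sat E"
  using sat.smult[of "binv_a E y" E "-1"] by (simp add: sat.ba zop_def[abs_def])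

lemma sat_poly_op: "y \<in> sat E \<Longrightarrow> poly_op E p y \<in> sat E"
  by (induction p arbitrary: y) (auto simp: poly_op_pCons sat_zero intro!: sat.add sat_const sat_zop)

lemma sat_support: "y \<in> sat E \<Longrightarrow> rk E \<le> i \<Longrightarrow> y i = 0"
  by (induction rule: sat.induct) (auto simp: vecs_def binv_a_def aopL_def)

section \<open>Invariance of the saturation and of the Bernstein polynomial\<close>

definition vmapL :: "nat \<Rightarrow> (nat \<Rightarrow> nat \<Rightarrow> complex fps) \<Rightarrow> lvec \<Rightarrow> lvec" where
  "vmapL k X x = (\<lambda>j. if j < k then \<Sum>i<k. x i * fps_to_fls (X i j) else 0)"

lemma fps_to_fls_sum: "fps_to_fls (\<Sum>i\<in>A. f i) = (\<Sum>i\<in>A. fps_to_fls (f i))"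
  by (induction A rule: infinite_finite_induct) auto

lemma aopL_vmapL:
  assumes "base_change E E' X C"
  shows "aopL E (vmapL (rk E) X x) = vmapL (rk E) X (aopL E' x)"
proof
  fix j
  define k where "k = rk E"
  let ?f = "fps_to_fls :: complex fps \<Rightarrow> _"
  have rk: "rk E = k" "rk E' = k" and
    eq: "\<And>i j. i < k \<Longrightarrow> j < k \<Longrightarrow> (\<Sum>l<k. X i l * mat E l j) + fps_X ^ 2 * fps_deriv (X i j) = (\<Sum>l<k. mat E' i l * X l j)"
    using assms by (auto simp: base_change_def k_def mmul_def)
  have eqL: "(\<Sum>l<k. ?f (X i l) * ?f (mat E l j)) + fls_X ^ 2 * fls_deriv (?f (X i j)) = (\<Sum>l<k. ?f (mat E' i l) * ?f (X l j))"
    if "i < k" "j < k" for i j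
    using arg_cong[OF eq[OF that], of ?f]
    by (simp add: fps_to_fls_sum fls_times_fps_to_fls fls_deriv_fps_to_fls fps_to_fls_power)
  show "aopL E (vmapL (rk E) X x) j = vmapL (rk E) X (aopL E' x) j"
  proof (cases "j < k")
    case True
    have "aopL E (vmapL k X x) j = (\<Sum>i<k. \<Sum>l<k. x l * (?f (X l i) * ?f (mat E i j))) + fls_X^2 * (\<Sum>l<k. x l * fls_deriv (?f (X l j)) + fls_deriv (x l) * ?f (X l j))"
      using True by (simp add: aopL_def vmapL_def rk fls_deriv_sum sum_distrib_right mult.assoc add.commute)
    also have "(\<Sum>i<k. \<Sum>l<k. x l * (?f (X l i) * ?f (mat E i j))) = (\<Sum>l<k. x l * (\<Sum>i<k. ?f (X l i) * ?f (mat E i j)))"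
      by (subst sum.swap) (simp add: sum_distrib_left)
    also have "\<dots> + fls_X^2 * (\<Sum>l<k. x l * fls_deriv (?f (X l j)) + fls_deriv (x l) * ?f (X l j))
       = (\<Sum>l<k. x l * ((\<Sum>i<k. ?f (X l i) * ?f (mat E i j)) + fls_X^2 * fls_deriv (?f (X l j)))) + (\<Sum>l<k. fls_X^2 * fls_deriv (x l) * ?f (X l j))"
      by (simp add: sum_distrib_left sum.distrib algebra_simps)
    also have "(\<Sum>l<k. x l * ((\<Sum>i<k. ?f (X l i) * ?f (mat E i j)) + fls_X^2 * fls_deriv (?f (X l j)))) = (\<Sum>l<k. x l * (\<Sum>i<k. ?f (mat E' l i) * ?f (X i j)))"
      using eqL True by simp
    also have "\<dots> = (\<Sum>i<k. (\<Sum>l<k. x l * ?f (mat E' l i)) * ?f (X i j))"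
      by (simp add: sum_distrib_left sum_distrib_right mult.assoc) (rule sum.swap)
    also have "\<dots> + (\<Sum>l<k. fls_X^2 * fls_deriv (x l) * ?f (X l j)) = vmapL k X (aopL E' x) j"
      using True by (simp add: aopL_def vmapL_def rk sum.distrib algebra_simps)
    finally show ?thesis by (simp add: k_def)
  qed (simp add: aopL_def vmapL_def rk)
qed

lemma vmapL_inverse:
  assumes "inverse_mats k X C" "\<And>i. k \<le> i \<Longrightarrow> x i = 0"
  shows "vmapL k C (vmapL k X x) = x"
proof
  fix j
  let ?f = "\<lambda>X i j. fps_to_fls (X i j) :: complex fls"
  have m: "mmul k (?f A) (?f B) i j = fps_to_fls (mmul k A B i j)" for A B i j
    by (simp add: mmul_def fps_to_fls_sum fls_times_fps_to_fls)
  have inv: "inverse_mats k (?f X) (?f C)"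
    using assms(1) by (simp add: inverse_mats_def m)
  show "vmapL k C (vmapL k X x) j = x j"
  proof (cases "j < k")
    case True
    have "vmapL k C (vmapL k X x) j = mmul k (mmul k (\<lambda>_. x) (?f X)) (?f C) 0 j"
      using True by (simp add: vmapL_def mmul_def)
    thus ?thesis using mmul_cancel_right[OF inv True, of "\<lambda>_. x" 0] by simp
  qed (simp add: vmapL_def assms(2))
qed

lemma vmapL_add: "vmapL k X (\<lambda>i. y i + z i) = (\<lambda>i. vmapL k X y i + vmapL k X z i)"
  by (auto simp: vmapL_def algebra_simps sum.distrib)

lemma vmapL_mult: "vmapL k X (\<lambda>i. s * y i) = (\<lambda>i. s * vmapL k X y i)"
  by (auto simp: vmapL_def algebra_simps sum_distrib_left)

lemma vmapL_zop:
  assumes "base_change E E' X C"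
  shows "zop E (vmapL (rk E) X y) = vmapL (rk E) X (zop E' y)"
  using vmapL_mult[of "rk E" X "-1" "\<lambda>i. fls_X_inv * aopL E' y i"]
  by (simp add: zop_def binv_a_def aopL_vmapL[OF assms] vmapL_mult)

lemma vmapL_poly_op:
  assumes "base_change E E' X C"
  shows "poly_op E p (vmapL (rk E) X y) = vmapL (rk E) X (poly_op E' p y)"
proof (induction p arbitrary: y)
  case 0
  show ?case by (auto simp: vmapL_def fun_eq_iff)
next
  case (pCons a p)
  thus ?case by (simp add: poly_op_pCons vmapL_add vmapL_mult vmapL_zop[OF assms])
qed

lemma vmapL_sat:
  assumes "base_change E E' X C" "y \<in> sat E'"
  shows "vmapL (rk E) X y \<in> sat E"
  using assms(2)
proof (induction rule: sat.induct)
  case (emb x)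
  have "vmapL (rk E) X (\<lambda>i. fps_to_fls (x i)) = (\<lambda>i. fps_to_fls (vmap (rk E) X x i))"
    by (auto simp: vmapL_def vmap_def fps_to_fls_sum fls_times_fps_to_fls)
  thus ?case by (auto intro!: sat.emb simp: vmap_def vecs_def)
next
  case (ba y)
  have "vmapL (rk E) X (binv_a E' y) = binv_a E (vmapL (rk E) X y)"
    by (simp add: binv_a_def aopL_vmapL[OF assms(1)] vmapL_mult)
  thus ?case using ba by (simp add: sat.ba)
qed (simp_all add: vmapL_add vmapL_mult sat.add sat.smult)

lemma annihilates_transfer:
  assumes "base_change E E' X C" "annihilates E' p"
  shows "annihilates E p"
  unfolding annihilates_def
proof
  fix y assume y: "y \<in> sat E"
  have rk: "rk E' = rk E" and inv: "inverse_mats (rk E) X C" using assms(1) by (auto simp: base_change_def)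
  define w where "w = vmapL (rk E) C y"
  have "w \<in> sat E'" using vmapL_sat[OF base_change_sym[OF assms(1)] y] by (simp add: w_def rk)
  then obtain z where z: "z \<in> sat E'" "poly_op E' p w = (\<lambda>k. fls_X * z k)"
    using assms(2) by (auto simp: annihilates_def)
  have "y = vmapL (rk E) X w"
    unfolding w_def using vmapL_inverse[OF inverse_mats_sym[OF inv], of y] sat_support[OF y] by simp
  hence "poly_op E p y = (\<lambda>k. fls_X * vmapL (rk E) X z k)"
    by (simp add: vmapL_poly_op[OF assms(1)] z(2) vmapL_mult)
  thus "\<exists>z\<in>sat E. poly_op E p y = (\<lambda>k. fls_X * z k)" using vmapL_sat[OF assms(1) z(1)] by blast
qed

lemma annihilates_cong:
  assumes "base_change E E' X C"
  shows "annihilates E p \<longleftrightarrow> annihilates E' p"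
  using annihilates_transfer[OF assms] annihilates_transfer[OF base_change_sym[OF assms]] by blast

lemma primitive_transfer:
  assumes "base_change E E' X C" "primitive E lam"
  shows "primitive E' lam"
proof -
  have "regular E'"
    using assms(2) regular_transfer[OF ab_iso_vmap[OF assms(1)]] by (simp add: primitive_def)
  thus ?thesis using assms(2) by (simp add: primitive_def is_bernstein_def annihilates_cong[OF assms(1)])
qed

section \<open>Primitivity of triangular modules\<close>

definition fls_ge :: "int \<Rightarrow> complex fls \<Rightarrow> bool" where
  "fls_ge m f \<longleftrightarrow> (\<forall>n<m. fls_nth f n = 0)"

lemma fls_ge_zero [simp]: "fls_ge m 0" by (simp add: fls_ge_def)

lemma fls_ge_add: "fls_ge m f \<Longrightarrow> fls_ge m g \<Longrightarrow> fls_ge m (f + g)"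
  by (simp add: fls_ge_def)

lemma fls_ge_mult_fps: "fls_ge m f \<Longrightarrow> fls_ge m (f * fps_to_fls S)"
proof (cases "f = 0")
  case False
  assume "fls_ge m f"
  hence m: "m \<le> fls_subdegree f" using False by (auto simp: fls_ge_def intro: fls_subdegree_geI)
  show ?thesis unfolding fls_ge_def
  proof (intro allI impI fls_times_nth_eq0)
    fix n assume "n < m"
    thus "n < fls_subdegree f + fls_subdegree (fps_to_fls S)"
      using m fls_subdegree_fls_to_fps_gt0[of S] by linarith
  qed
qed simp

lemma fls_nth_X_mult [simp]: "fls_nth (fls_X * (f :: complex fls)) n = fls_nth f (n - 1)"
  by (simp add: fls_X_times_conv_shift)

lemma fls_nth_X_inv_mult [simp]: "fls_nth (fls_X_inv * (f :: complex fls)) n = fls_nth f (n + 1)"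
  by (simp add: fls_X_inv_times_conv_shift)

lemma fls_nth_sum: "fls_nth (\<Sum>i\<in>A. f i) n = (\<Sum>i\<in>A. fls_nth (f i) n)"
  by (induction A rule: infinite_finite_induct) auto

text \<open>On \<open>b^n e_j\<close> the diagonal part of \<open>- b^-1 a\<close> is the scalar
  \<open>-(\<lambda>_j + n)\<close>, with \<open>n\<close> coming from the derivation. Later
  coordinates enter one degree higher because of the factor \<open>b^-1\<close>.\<close>

lemma zop_nth:
  assumes "triangular E ls" "j < rk E"
  shows "fls_nth (zop E y j) n = - ((of_rat (ls ! j) + of_int n) * fls_nth (y j) n)
     - (\<Sum>i\<in>{j<..<rk E}. fls_nth (y i * fps_to_fls (mat E i j)) (n + 1))"
proof -
  have "(\<Sum>i<rk E. y i * fps_to_fls (mat E i j)) = (\<Sum>i\<in>insert j {j<..<rk E}. y i * fps_to_fls (mat E i j))"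
    by (rule sum.mono_neutral_right)
       (use assms in \<open>auto simp: not_less triangularD(3)[OF assms(1)] intro: linorder_cases[of _ j]\<close>)
  also have "\<dots> = fls_X * (fls_const (of_rat (ls ! j)) * y j) + (\<Sum>i\<in>{j<..<rk E}. y i * fps_to_fls (mat E i j))"
    using assms by (simp add: triangularD(2)[OF assms(1)] fls_times_fps_to_fls mult_ac)
  finally have s: "(\<Sum>i<rk E. y i * fps_to_fls (mat E i j))
     = fls_X * (fls_const (of_rat (ls ! j)) * y j) + (\<Sum>i\<in>{j<..<rk E}. y i * fps_to_fls (mat E i j))" .
  show ?thesis
    using assms(2) unfolding zop_def binv_a_def aopL_def s
    by (simp add: fls_nth_sum power2_eq_square mult.assoc) (simp add: algebra_simps)
qed

section \<open>An explicit multiple of the Bernstein polynomial\<close>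

lemma poly_op_linear:
  "poly_op E [:\<mu>, 1:] y = (\<lambda>i. fls_const \<mu> * y i + zop E y i)"
  by (simp add: poly_op_pCons)

text \<open>Coordinate \<open>i\<close> is allowed poles of order \<open>rk E - 1 - i\<close>: this lattice is stable under
  \<open>b\<^sup>-\<^sup>1 a\<close> whatever the entries below the diagonal are.  In \<open>lattice E m r\<close> it is
  multiplied by \<open>b\<^sup>m\<close>, and by \<open>b\<^sup>m\<^sup>+\<^sup>1\<close> in the coordinates from \<open>r\<close> on.\<close>
definition lattice :: "abmod \<Rightarrow> int \<Rightarrow> nat \<Rightarrow> lvec set" where
  "lattice E m r = {y. (\<forall>i\<ge>rk E. y i = 0) \<and>
     (\<forall>i<rk E. fls_ge (m + of_bool (r \<le> i) - int (rk E - 1 - i)) (y i))}"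

text \<open>The negative of the scalar by which \<open>zop\<close> acts, through the diagonal, in
  degree \<open>m - (rk E - 1 - i)\<close>, the lowest one allowed in a coordinate \<open>i\<close>
  of \<open>lattice E m r\<close> with \<open>i < r\<close>.\<close>

definition expo :: "abmod \<Rightarrow> rat list \<Rightarrow> int \<Rightarrow> nat \<Rightarrow> complex" where
  "expo E ls m i = of_rat (ls ! i) + of_int (m - int (rk E - 1 - i))"

text \<open>The guaranteed order rises by at least one with each coordinate, which pays for the
  shift by one in \<open>zop_nth\<close>; the next coordinate is the worst case.\<close>

lemma lattice_off_diagonal:
  assumes "y \<in> lattice E m r" "i < rk E" "Suc i < rk E \<Longrightarrow> n + 1 < m + of_bool (r \<le> Suc i) - int (rk E - 1 - Suc i)"
  shows "(\<Sum>l\<in>{i<..<rk E}. fls_nth (y l * fps_to_fls (mat E l i)) (n + 1)) = 0"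
proof (rule sum.neutral, rule ballI)
  fix l assume l: "l \<in> {i<..<rk E}"
  hence "fls_ge (m + of_bool (r \<le> l) - int (rk E - 1 - l)) (y l)" using assms(1) by (simp add: lattice_def)
  moreover have "n + 1 < m + of_bool (r \<le> l) - int (rk E - 1 - l)"
    using assms(3) l by (auto simp: of_bool_def split: if_splits)
  ultimately show "fls_nth (y l * fps_to_fls (mat E l i)) (n + 1) = 0"
    using fls_ge_mult_fps by (simp add: fls_ge_def)
qed

lemma zop_support: "rk E \<le> i \<Longrightarrow> zop E y i = 0"
  by (simp add: zop_def binv_a_def aopL_def)

text \<open>The linear factor kills the lowest coefficient of coordinate \<open>r\<close>. The
  coordinates after \<open>r\<close> already carry the extra power of \<open>b\<close>, so they
  cannot restore it; this is why coordinates are treated from the last to the first.\<close>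

lemma lattice_step:
  assumes "triangular E ls" "y \<in> lattice E m (Suc r)" "r < rk E"
  shows "poly_op E [:expo E ls m r, 1:] y \<in> lattice E m r"
  unfolding lattice_def mem_Collect_eq poly_op_linear
proof (intro conjI allI impI)
  fix i assume "rk E \<le> i"
  thus "fls_const (expo E ls m r) * y i + zop E y i = 0"
    using assms(2) by (simp add: zop_support lattice_def)
next
  fix i assume i: "i < rk E"
  show "fls_ge (m + of_bool (r \<le> i) - int (rk E - 1 - i)) (fls_const (expo E ls m r) * y i + zop E y i)"
    unfolding fls_ge_def
  proof (intro allI impI)
    fix n assume n: "n < m + of_bool (r \<le> i) - int (rk E - 1 - i)"
    have "(\<Sum>l\<in>{i<..<rk E}. fls_nth (y l * fps_to_fls (mat E l i)) (n + 1)) = 0"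
      using assms(2) i n by (intro lattice_off_diagonal) (auto simp: of_nat_diff of_bool_def split: if_splits)
    hence "fls_nth (fls_const (expo E ls m r) * y i + zop E y i) n
       = (expo E ls m r - of_rat (ls ! i) - of_int n) * fls_nth (y i) n"
      unfolding fls_plus_nth zop_nth[OF assms(1) i] fls_mult_const_nth by (simp add: algebra_simps)
    also have "\<dots> = 0"
    proof (cases "n < m + of_bool (Suc r \<le> i) - int (rk E - 1 - i)")
      case True
      thus ?thesis using assms(2) i by (simp add: lattice_def fls_ge_def)
    next
      case False
      hence "i = r" "n = m - int (rk E - 1 - r)" using n by (auto simp: of_bool_def split: if_splits)
      thus ?thesis by (simp add: expo_def)
    qed
    finally show "fls_nth (fls_const (expo E ls m r) * y i + zop E y i) n = 0" .
  qed
qed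

lemma lattice_shift:
  assumes "triangular E ls" "y \<in> lattice E m r" "r \<le> rk E"
  shows "poly_op E (\<Prod>i<r. [:expo E ls m i, 1:]) y \<in> lattice E m 0"
  using assms(2,3)
proof (induction r arbitrary: y)
  case (Suc r)
  thus ?case using lattice_step[OF assms(1), of y m r] by (simp only: poly_op_prod_lessThan_Suc)
qed (simp add: poly_op_pCons one_pCons)

lemma lattice_Suc: "lattice E m 0 = lattice E (m + 1) (rk E)"
  by (auto simp: lattice_def)

text \<open>The factors for one value of \<open>m\<close> gain one power of \<open>b\<close> in the
  whole lattice. With \<open>M = rk E\<close> the gain exceeds the largest pole, of order
  \<open>rk E - 1\<close>.\<close>

definition bern_multiple :: "abmod \<Rightarrow> rat list \<Rightarrow> nat \<Rightarrow> complex poly" where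
  "bern_multiple E ls M = (\<Prod>m<M. \<Prod>i<rk E. [:expo E ls (int m) i, 1:])"

lemma lattice_bern_multiple:
  assumes "triangular E ls" "y \<in> lattice E 0 (rk E)"
  shows "poly_op E (bern_multiple E ls M) y \<in> lattice E (int M) (rk E)"
proof (induction M)
  case 0
  thus ?case using assms(2) by (simp add: bern_multiple_def poly_op_pCons one_pCons)
next
  case (Suc M)
  have "bern_multiple E ls (Suc M) = (\<Prod>i<rk E. [:expo E ls (int M) i, 1:]) * bern_multiple E ls M"
    by (simp add: bern_multiple_def)
  thus ?case using lattice_shift[OF assms(1) Suc order_refl]
    by (simp add: poly_op_mult lattice_Suc add.commute)
qed

lemma sat_subset_lattice:
  assumes "triangular E ls"
  shows "sat E \<subseteq> lattice E 0 (rk E)"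
proof
  fix y assume "y \<in> sat E"
  thus "y \<in> lattice E 0 (rk E)"
  proof (induction rule: sat.induct)
    case (emb x)
    thus ?case by (auto simp: lattice_def vecs_def fls_ge_def)
  next
    case (add y z)
    thus ?case by (auto simp: lattice_def intro: fls_ge_add)
  next
    case (smult y S)
    thus ?case by (auto simp: lattice_def mult.commute[of "fps_to_fls S"] fls_ge_mult_fps)
  next
    case (ba y)
    have "zop E y \<in> lattice E 0 (rk E)" unfolding lattice_def mem_Collect_eq
    proof (intro conjI allI impI)
      fix i assume i: "i < rk E"
      show "fls_ge (0 + of_bool (rk E \<le> i) - int (rk E - 1 - i)) (zop E y i)" unfolding fls_ge_def
      proof (intro allI impI)
        fix n assume n: "n < 0 + of_bool (rk E \<le> i) - int (rk E - 1 - i)"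
        hence *: "fls_nth (y i) n = 0" using i ba(2) by (auto simp: lattice_def fls_ge_def)
        have "(\<Sum>l\<in>{i<..<rk E}. fls_nth (y l * fps_to_fls (mat E l i)) (n + 1)) = 0"
          using ba(2) i n * by (intro lattice_off_diagonal) (auto simp: of_nat_diff)
        thus "fls_nth (zop E y i) n = 0" using zop_nth[OF assms i, of y n] * by simp
      qed
    qed (simp add: zop_support)
    thus ?case by (auto simp: lattice_def zop_def fls_ge_def)
  qed
qed

text \<open>Here coordinate \<open>i\<close> has order at least \<open>i + 1\<close>, so
  \<open>y\<close> even lies in \<open>bE\<close>.\<close>

lemma lattice_subset_sat:
  assumes "y \<in> lattice E (int (rk E)) (rk E)"
  shows "\<exists>z\<in>sat E. y = (\<lambda>k. fls_X * z k)"
proof -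
  have n: "fls_nth (y i) n = 0" if "n < 1" for i n
  proof (cases "i < rk E")
    case True
    hence "n < int (rk E) + of_bool (rk E \<le> i) - int (rk E - 1 - i)" using that by auto
    thus ?thesis using assms True by (simp add: lattice_def fls_ge_def)
  qed (use assms in \<open>simp add: lattice_def\<close>)
  have "(\<lambda>i. fps_to_fls (fls_regpart (fls_X_inv * y i))) \<in> sat E"
    using assms by (intro sat.emb) (auto simp: vecs_def lattice_def)
  moreover have "y = (\<lambda>i. fls_X * fps_to_fls (fls_regpart (fls_X_inv * y i)))"
    by (intro ext fls_eqI) (auto simp: n)
  ultimately show ?thesis
    by (intro bexI[of _ "\<lambda>i. fps_to_fls (fls_regpart (fls_X_inv * y i))"])
qed

lemma annihilates_bern_multiple:
  assumes "triangular E ls"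
  shows "annihilates E (bern_multiple E ls (rk E))"
  unfolding annihilates_def
  using lattice_subset_sat lattice_bern_multiple[OF assms] sat_subset_lattice[OF assms] by blast

lemma lead_coeff_bern_multiple: "lead_coeff (bern_multiple E ls M) = 1"
  by (simp add: bern_multiple_def lead_coeff_prod)

text \<open>Annihilating polynomials form an ideal, since \<open>sat E\<close> is stable under
  \<open>poly_op\<close>. A nonzero remainder of \<open>q\<close> modulo \<open>p\<close>, made
  monic, would contradict the minimality of the degree of \<open>p\<close>.\<close>

lemma is_bernstein_dvd:
  assumes "is_bernstein E p" "annihilates E q"
  shows "p dvd q"
proof (rule ccontr)
  assume "\<not> p dvd q"
  define r where "r = q mod p"
  have r0: "r \<noteq> 0" using \<open>\<not> p dvd q\<close> by (simp add: r_def dvd_eq_mod_eq_0)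
  have p: "annihilates E p" "lead_coeff p = 1" "\<And>q. lead_coeff q = 1 \<Longrightarrow> annihilates E q \<Longrightarrow> degree p \<le> degree q"
    using assms(1) by (auto simp: is_bernstein_def)
  have "p \<noteq> 0" using p(2) by auto
  define s where "s = smult (inverse (lead_coeff r)) r"
  have "s = smult (inverse (lead_coeff r)) q + p * smult (- inverse (lead_coeff r)) (q div p)"
    unfolding s_def r_def using div_mult_mod_eq[of q p]
    by (simp add: minus_div_mult_eq_mod[symmetric] smult_diff_right mult.commute)
  moreover have "annihilates E (smult c q + p * t)" for c t
    unfolding annihilates_def
  proof
    fix y assume y: "y \<in> sat E"
    obtain z1 where z1: "z1 \<in> sat E" "poly_op E q y = (\<lambda>k. fls_X * z1 k)"
      using assms(2) y by (auto simp: annihilates_def)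
    obtain z2 where z2: "z2 \<in> sat E" "poly_op E p (poly_op E t y) = (\<lambda>k. fls_X * z2 k)"
      using p(1) sat_poly_op[OF y] by (auto simp: annihilates_def)
    have "(\<lambda>k. fls_const c * z1 k + z2 k) \<in> sat E" by (intro sat.add sat_const z1 z2)
    moreover have "poly_op E (smult c q + p * t) y = (\<lambda>k. fls_X * (fls_const c * z1 k + z2 k))"
      by (simp add: poly_op_add poly_op_smult poly_op_mult z1 z2 algebra_simps)
    ultimately show "\<exists>z\<in>sat E. poly_op E (smult c q + p * t) y = (\<lambda>k. fls_X * z k)"
      by (intro bexI[of _ "\<lambda>k. fls_const c * z1 k + z2 k"])
  qed
  ultimately have "annihilates E s" by (simp only:)
  moreover have "lead_coeff s = 1" using r0 by (simp add: s_def)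
  ultimately have "degree p \<le> degree s" using p(3) by blast
  moreover have "degree s = degree r" using r0 by (simp add: s_def)
  moreover have "degree r < degree p" using r0 \<open>p \<noteq> 0\<close> degree_mod_less[of p q] by (auto simp: r_def)
  ultimately show False by simp
qed

lemma is_bernstein_exists:
  assumes "annihilates E q" "lead_coeff q = 1"
  shows "\<exists>p. is_bernstein E p"
  unfolding is_bernstein_def
  using assms ex_has_least_nat[of "\<lambda>p. lead_coeff p = 1 \<and> annihilates E p" q degree] by blast

section \<open>Regularity, and the Bernstein roots against the diagonal\<close>

lemma X2_deriv_X_power:
  "fps_X ^ 2 * fps_deriv (fps_X ^ n) = (of_nat n * fps_X * fps_X ^ n :: complex fps)"
proof (induction n)
  case (Suc n)
  have "fps_X ^ 2 * fps_deriv (fps_X ^ Suc n)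
      = fps_X * (fps_X ^ 2 * fps_deriv (fps_X ^ n)) + (fps_X ^ 2 * fps_X ^ n :: complex fps)"
    by (simp add: algebra_simps)
  also have "\<dots> = of_nat (Suc n) * fps_X * fps_X ^ Suc n"
    unfolding Suc by (simp add: algebra_simps power2_eq_square)
  finally show ?case .
qed simp

text \<open>\<open>E'\<close> is the lattice with basis \<open>b^(-N i) e_i\<close>, and
  \<open>D\<close> is the matrix of \<open>b^-1 a\<close> in it. Since \<open>N\<close> drops by one
  at each index, an entry below the diagonal gains \<open>b^(i-j)\<close>, enough to divide by
  \<open>b\<close>; the derivation subtracts \<open>N i\<close> on the diagonal.\<close>

lemma regular_triangular:
  assumes "triangular E ls"
  shows "regular E"
proof -
  define k where "k = rk E"
  define N where "N = (\<lambda>i. k - 1 - i)"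
  define D where "D = (\<lambda>i j. if j < i then fps_X ^ (i - j - 1) * mat E i j
     else if j = i then fps_const (of_rat (ls ! i) - of_nat (N i)) else 0)"
  define E' :: abmod where "E' = (k, \<lambda>i j. fps_X * D i j)"
  define g :: "abvec \<Rightarrow> abvec" where "g = (\<lambda>x i. fps_X ^ N i * x i)"
  have rk: "rk E' = k" by (simp add: E'_def rk_def)
  have diag: "(\<Sum>i<k. x i * A i j) = x j * A j j + (\<Sum>i\<in>{j<..<k}. x i * A i j)"
    if "j < k" "\<And>i j. i < j \<Longrightarrow> j < k \<Longrightarrow> A i j = 0" for x :: abvec and A j
  proof -
    have "(\<Sum>i<k. x i * A i j) = (\<Sum>i\<in>insert j {j<..<k}. x i * A i j)"
      by (rule sum.mono_neutral_right) (use that in \<open>auto intro: linorder_cases[of _ j]\<close>)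
    thus ?thesis by simp
  qed
  have a: "g (aop E x) j = aop E' (g x) j" for x j
  proof (cases "j < k")
    case True
    have off: "fps_X ^ N j * (x i * mat E i j) = fps_X ^ N i * x i * (fps_X * D i j)" if "i \<in> {j<..<k}" for i
    proof -
      have "N j = N i + 1 + (i - j - 1)" using that by (auto simp: N_def)
      hence "fps_X ^ N j = (fps_X ^ N i * fps_X * fps_X ^ (i - j - 1) :: complex fps)"
        by (simp only: power_add power_one_right)
      thus ?thesis using that by (simp add: D_def mult_ac)
    qed
    have der: "fps_X ^ 2 * fps_deriv (fps_X ^ N j * x j)
       = fps_X ^ N j * (fps_X ^ 2 * fps_deriv (x j)) + of_nat (N j) * fps_X * (fps_X ^ N j * x j)"
      using X2_deriv_X_power[of "N j"] by (simp add: algebra_simps)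
    have "aop E x j = fps_const (of_rat (ls ! j)) * fps_X * x j + (\<Sum>i\<in>{j<..<k}. x i * mat E i j) + fps_X ^ 2 * fps_deriv (x j)"
      using diag[of j "mat E" x] True assms by (simp add: aop_def triangularD k_def mult.commute)
    hence "g (aop E x) j = fps_X ^ N j * (fps_const (of_rat (ls ! j)) * fps_X * x j)
       + (\<Sum>i\<in>{j<..<k}. fps_X ^ N i * x i * (fps_X * D i j)) + fps_X ^ N j * (fps_X ^ 2 * fps_deriv (x j))"
      unfolding g_def by (simp only: distrib_left sum_distrib_left off cong: sum.cong)
    also have "\<dots> = fps_X ^ N j * x j * (fps_X * D j j) + (\<Sum>i\<in>{j<..<k}. fps_X ^ N i * x i * (fps_X * D i j))
        + fps_X ^ 2 * fps_deriv (fps_X ^ N j * x j)"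
      unfolding der by (simp add: D_def algebra_simps fps_of_nat flip: fps_const_sub)
    also have "\<dots> = aop E' (g x) j"
      using diag[of j "\<lambda>i j. fps_X * D i j" "g x"] True
      by (simp add: aop_def rk g_def) (simp add: E'_def mat_def D_def)
    finally show ?thesis .
  qed (simp add: aop_def g_def rk k_def)
  have "ab_hom E E' g"
    unfolding ab_hom_def using a
    by (auto simp: vecs_def vadd_def vsmult_def rk) (auto simp: g_def k_def algebra_simps fun_eq_iff)
  moreover have "inj_on g (vecs E)"
    by (intro inj_onI ext) (auto simp: g_def fun_eq_iff)
  moreover have "\<exists>z\<in>vecs E'. aop E' y = vsmult fps_X z" for y
  proof (intro bexI[of _ "\<lambda>j. if j < k then (\<Sum>i<k. y i * D i j) + fps_X * fps_deriv (y j) else 0"])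
    show "aop E' y = vsmult fps_X (\<lambda>j. if j < k then (\<Sum>i<k. y i * D i j) + fps_X * fps_deriv (y j) else 0)"
      by (auto simp: aop_def vsmult_def rk fun_eq_iff sum_distrib_left algebra_simps power2_eq_square)
         (simp add: E'_def mat_def algebra_simps)
  qed (simp add: vecs_def rk)
  ultimately show ?thesis unfolding regular_def by blast
qed

lemma primitive_triangular:
  assumes "triangular E ls" "\<And>i. i < rk E \<Longrightarrow> \<exists>n::int. ls ! i = lam + of_int n"
  shows "primitive E lam"
  unfolding primitive_def
proof (intro conjI allI impI)
  fix p z assume p: "is_bernstein E p" and z: "poly p z = 0"
  have "poly (bern_multiple E ls (rk E)) z = 0"
    using is_bernstein_dvd[OF p annihilates_bern_multiple[OF assms(1)]] z by (auto simp: dvd_def)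
  then obtain m i where "i < rk E" "expo E ls (int m) i + z = 0"
    by (auto simp: bern_multiple_def poly_prod)
  moreover obtain n where "ls ! i = lam + of_int n" using assms(2) \<open>i < rk E\<close> by blast
  ultimately have "z = of_rat (- lam) + of_int (- n - (int m - int (rk E - 1 - i)))"
    by (simp add: expo_def of_rat_add of_rat_minus add_eq_0_iff2 algebra_simps)
  thus "\<exists>m::int. z = of_rat (- lam) + of_int m" by blast
qed (rule regular_triangular[OF assms(1)])

text \<open>For a vector that ends at coordinate \<open>j\<close>, only the diagonal feeds that
  coordinate. There \<open>zop\<close> multiplies the coefficient of degree \<open>n\<close> by a
  scalar, so \<open>p\<close> acts by evaluation at it.\<close>

lemma poly_op_top_coordinate:
  assumes "triangular E ls" "j < rk E" "\<And>i. j < i \<Longrightarrow> y i = 0"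
  shows "\<And>i. j < i \<Longrightarrow> poly_op E p y i = 0"
    and "fls_nth (poly_op E p y j) n = poly p (- (of_rat (ls ! j) + of_int n)) * fls_nth (y j) n"
proof -
  have "(\<forall>i>j. poly_op E p y i = 0) \<and>
     fls_nth (poly_op E p y j) n = poly p (- (of_rat (ls ! j) + of_int n)) * fls_nth (y j) n"
    using assms(3)
  proof (induction p arbitrary: y)
    case (pCons a p)
    have z: "zop E y i = 0" if "j < i" for i
    proof (cases "i < rk E")
      case True
      thus ?thesis using zop_nth[OF assms(1) True, of y] pCons.prems that by (intro fls_eqI) simp
    qed (simp add: zop_support)
    have "fls_nth (zop E y j) n = - (of_rat (ls ! j) + of_int n) * fls_nth (y j) n"
      using zop_nth[OF assms(1,2), of y n] pCons.prems by (simp add: algebra_simps)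
    hence "fls_nth (poly_op E p (zop E y) j) n
       = poly p (- (of_rat (ls ! j) + of_int n)) * (- (of_rat (ls ! j) + of_int n) * fls_nth (y j) n)"
      using pCons.IH[of "zop E y"] z by simp
    thus ?case using pCons.IH[of "zop E y"] z pCons.prems
      unfolding poly_op_pCons fls_plus_nth by (simp add: ring_distribs mult_ac)
  qed simp
  thus "\<And>i. j < i \<Longrightarrow> poly_op E p y i = 0"
    "fls_nth (poly_op E p y j) n = poly p (- (of_rat (ls ! j) + of_int n)) * fls_nth (y j) n" by auto
qed

text \<open>Among the elements of the saturation that end at coordinate \<open>j\<close>, one is
  taken whose \<open>j\<close>-th coordinate reaches the lowest degree n. The Bernstein polynomial
  maps it into \<open>b E^#\<close>, so its coefficient of degree n dies, and
  \<open>-(\<lambda>_j + n)\<close> is a root.\<close>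

lemma primitive_imp_diagonal:
  assumes "triangular E ls" "primitive E lam" "j < rk E"
  shows "\<exists>n::int. ls ! j = lam + of_int n"
proof -
  obtain p where p: "is_bernstein E p"
    using is_bernstein_exists annihilates_bern_multiple[OF assms(1)] lead_coeff_bern_multiple by blast
  define V where "V = {y \<in> sat E. \<forall>i>j. y i = 0}"
  \<comment> \<open>The lattice bounds the pole order by \<open>c\<close>; shifting degrees by
    \<open>c\<close> makes them natural numbers, among which a least one exists.\<close>
  define c where "c = int (rk E - 1 - j)"
  have ge: "- c \<le> n" if "y \<in> V" "fls_nth (y j) n \<noteq> 0" for y n
    using that sat_subset_lattice[OF assms(1)] assms(3)
    by (force simp: V_def lattice_def fls_ge_def c_def not_less)
  define P where "P = (\<lambda>s::nat. \<exists>y\<in>V. fls_nth (y j) (int s - c) \<noteq> 0)"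
  have "(\<lambda>i. fps_to_fls (uvec j i)) \<in> V"
    using assms(3) by (auto simp: V_def uvec_def vecs_def intro!: sat.emb)
  hence "P (nat c)" unfolding P_def by (intro bexI[of _ "\<lambda>i. fps_to_fls (uvec j i)"]) (auto simp: uvec_def c_def)
  then obtain s where s: "P s" "\<And>t. t < s \<Longrightarrow> \<not> P t" by (metis exists_least_iff)
  from s(1) obtain y where y: "y \<in> V" "fls_nth (y j) (int s - c) \<noteq> 0" by (auto simp: P_def)
  have ys: "y \<in> sat E" "\<And>i. j < i \<Longrightarrow> y i = 0" using y(1) by (auto simp: V_def)
  obtain z where z: "z \<in> sat E" "poly_op E p y = (\<lambda>k. fls_X * z k)"
    using p ys(1) by (auto simp: is_bernstein_def annihilates_def)
  note top = poly_op_top_coordinate[where y = y, OF assms(1,3) ys(2)]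
  have "z i = 0" if "j < i" for i
    using top(1)[where p = p, OF _ that] z(2) by simp
  hence "z \<in> V" using z(1) by (simp add: V_def)
  have "fls_nth (z j) (int s - c - 1) = 0"
  proof (rule ccontr)
    assume nz: "fls_nth (z j) (int s - c - 1) \<noteq> 0"
    hence "s \<noteq> 0" using ge[OF \<open>z \<in> V\<close> nz] by auto
    hence "P (s - 1)" using nz \<open>z \<in> V\<close> by (auto simp: P_def of_nat_diff algebra_simps)
    thus False using s(2)[of "s - 1"] \<open>s \<noteq> 0\<close> by simp
  qed
  hence "poly p (- (of_rat (ls ! j) + of_int (int s - c))) * fls_nth (y j) (int s - c) = 0"
    using top(2)[where p = p and n = "int s - c"] z(2) by simp
  hence "poly p (- (of_rat (ls ! j) + of_int (int s - c))) = 0" using y(2) by simp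
  then obtain m :: int where "- (of_rat (ls ! j) + of_int (int s - c)) = (of_rat (- lam) + of_int m :: complex)"
    using assms(2) p unfolding primitive_def by blast
  hence "(of_rat (ls ! j) :: complex) = of_rat lam + of_int (c - int s - m)"
    by (simp add: of_rat_minus algebra_simps)
  hence "(of_rat (ls ! j) :: complex) = of_rat (lam + of_int (c - int s - m))"
    by (simp only: of_rat_add of_rat_of_int_eq)
  hence "ls ! j = lam + of_int (c - int s - m)" using of_rat_eq_iff by blast
  thus ?thesis by blast
qed

section \<open>Pivots of a theme\<close>

definition pivots :: "abmod \<Rightarrow> rat list \<Rightarrow> bool" where
  "pivots E ls \<longleftrightarrow> (\<forall>j. Suc j < rk E \<longrightarrow> fps_nth (mat E (Suc j) j) 0 \<noteq> 0 \<and>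
     (\<exists>p. ls ! Suc j - ls ! j + 1 = of_nat p \<and> fps_nth (mat E (Suc j) j) p \<noteq> 0))"

text \<open>Stated through submodules, so that the kernel of a functional can be set against it
  directly.\<close>

definition generator :: "abmod \<Rightarrow> abvec \<Rightarrow> bool" where
  "generator E v \<longleftrightarrow> v \<in> vecs E \<and> (\<forall>S. submod E S \<longrightarrow> v \<in> S \<longrightarrow> S = vecs E)"

text \<open>\<psi> is a functional on \<open>E/bE\<close>. Diagonal entries vanish at b = 0, so the
  assumption on rows says that it kills \<open>aE\<close>, and a kernel containing \<open>aE\<close>
  is stable under \<open>a\<close>.\<close>

lemma submod_functional:
  assumes "triangular E ls" "\<And>l. l < rk E \<Longrightarrow> (\<Sum>i<l. fps_nth (mat E l i) 0 * \<psi> i) = 0"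
  shows "submod E {x \<in> vecs E. (\<Sum>i<rk E. fps_nth (x i) 0 * \<psi> i) = 0}"
proof -
  have row: "(\<Sum>i<rk E. fps_nth (mat E l i) 0 * \<psi> i) = 0" if "l < rk E" for l
  proof -
    have "fps_nth (mat E l i) 0 = 0" if "l \<le> i" "i < rk E" for i
      using that triangularD(2,3)[OF assms(1)] by (cases "l = i") auto
    hence "(\<Sum>i<rk E. fps_nth (mat E l i) 0 * \<psi> i) = (\<Sum>i<l. fps_nth (mat E l i) 0 * \<psi> i)"
      using that by (intro sum.mono_neutral_right) (auto simp: not_less)
    thus ?thesis using assms(2)[OF that] by simp
  qed
  have "(\<Sum>j<rk E. fps_nth (aop E x j) 0 * \<psi> j) = 0" for x
  proof -
    have "(\<Sum>j<rk E. fps_nth (aop E x j) 0 * \<psi> j)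
        = (\<Sum>j<rk E. \<Sum>l<rk E. fps_nth (x l) 0 * (fps_nth (mat E l j) 0 * \<psi> j))"
      by (intro sum.cong) (simp_all add: aop_def fps_sum_nth sum_distrib_right mult.assoc)
    also have "\<dots> = (\<Sum>l<rk E. fps_nth (x l) 0 * (\<Sum>j<rk E. fps_nth (mat E l j) 0 * \<psi> j))"
      by (subst sum.swap) (simp add: sum_distrib_left)
    finally show ?thesis using row by simp
  qed
  moreover have "aop E x \<in> vecs E" for x by (simp add: vecs_def aop_def)
  ultimately show ?thesis
    by (auto simp: submod_def vadd_def vsmult_def distrib_right sum.distrib mult.assoc simp flip: sum_distrib_left)
       (auto simp: vecs_def)
qed

text \<open>If the constant term of some subdiagonal entry vanished, the last such entry would yield a
  nonzero functional on \<open>E/bE\<close> that kills \<open>aE\<close> and the generator.\<close>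
lemma generator_imp_subdiagonal_unit:
  assumes "triangular E ls" "generator E v" "Suc j < rk E"
  shows "fps_nth (mat E (Suc j) j) 0 \<noteq> 0"
proof
  assume z: "fps_nth (mat E (Suc j) j) 0 = 0"
  define k where "k = rk E"
  let ?m = "\<lambda>l i. fps_nth (mat E l i) 0"
  \<comment> \<open>A functional that kills \<open>aE\<close> and the generator has a submodule
    containing the generator as kernel, so it is zero.\<close>
  have kill: "\<psi> i = 0" if "\<And>l. l < k \<Longrightarrow> (\<Sum>i<l. ?m l i * \<psi> i) = 0" "(\<Sum>i<k. fps_nth (v i) 0 * \<psi> i) = 0" "i < k"
    for \<psi> i
  proof -
    have "{x \<in> vecs E. (\<Sum>i<k. fps_nth (x i) 0 * \<psi> i) = 0} = vecs E"
      using assms(2) submod_functional[OF assms(1), of \<psi>] that unfolding generator_def k_def by blast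
    moreover have "uvec i \<in> vecs E" using that(3) by (auto simp: uvec_def vecs_def k_def)
    ultimately have "(\<Sum>l<k. fps_nth (uvec i l) 0 * \<psi> l) = 0" by blast
    moreover have "(\<Sum>l<k. fps_nth (uvec i l) 0 * \<psi> l) = (\<Sum>l<k. if l = i then \<psi> l else 0)"
      by (intro sum.cong) (auto simp: uvec_def)
    ultimately show ?thesis using that(3) by simp
  qed
  define J where "J = (GREATEST j. Suc j < k \<and> ?m (Suc j) j = 0)"
  have J: "Suc J < k" "?m (Suc J) J = 0"
    using GreatestI_nat[of "\<lambda>j. Suc j < k \<and> ?m (Suc j) j = 0" j k] z assms(3) by (auto simp: J_def k_def)
  have Jmax: "?m (Suc i) i \<noteq> 0" if "J < i" "Suc i < k" for i
    using Greatest_le_nat[of "\<lambda>j. Suc j < k \<and> ?m (Suc j) j = 0" i k] that by (auto simp: J_def)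
  \<comment> \<open>The functional picking the last coordinate always kills \<open>aE\<close>; it
    must therefore not kill \<open>v\<close>.\<close>
  have last: "fps_nth (v (k - 1)) 0 \<noteq> 0"
  proof
    assume v0: "fps_nth (v (k - 1)) 0 = 0"
    define \<psi> where "\<psi> = (\<lambda>i. if i = k - 1 then 1 else 0 :: complex)"
    have "\<psi> (k - 1) = 0"
    proof (rule kill)
      show "(\<Sum>i<l. ?m l i * \<psi> i) = 0" if "l < k" for l
        using that by (intro sum.neutral) (auto simp: \<psi>_def)
      show "(\<Sum>i<k. fps_nth (v i) 0 * \<psi> i) = 0"
        using v0 by (intro sum.neutral) (auto simp: \<psi>_def)
    qed (use J in simp)
    thus False by (simp add: \<psi>_def)
  qed
  \<comment> \<open>The start is the functional at \<open>J\<close>: row \<open>J + 1\<close>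
    accepts it because its entry at \<open>J\<close> vanishes. Each later row \<open>n + 1\<close>
    is solved for \<open>\<psi> n\<close>, whose coefficient is nonzero by the choice of
    \<open>J\<close>.\<close>
  have "\<exists>\<psi>. \<psi> J = 1 \<and> (\<forall>i<J. \<psi> i = 0) \<and> (\<forall>l\<le>Suc J + d. (\<Sum>i<l. ?m l i * \<psi> i) = 0)" if "Suc J + d < k" for d
    using that
  proof (induction d)
    case 0
    have "(\<Sum>i<l. ?m l i * (if i = J then 1 else 0)) = 0" if "l \<le> Suc J" for l
      using that J by (cases "l = Suc J") (auto intro!: sum.neutral)
    thus ?case by (intro exI[of _ "\<lambda>i. if i = J then 1 else 0"]) auto
  next
    case (Suc d)
    then obtain \<psi> where \<psi>: "\<psi> J = 1" "\<forall>i<J. \<psi> i = 0" "\<And>l. l \<le> Suc J + d \<Longrightarrow> (\<Sum>i<l. ?m l i * \<psi> i) = 0" by auto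
    define n where "n = Suc J + d"
    have n: "?m (Suc n) n \<noteq> 0" using Suc.prems by (intro Jmax) (auto simp: n_def)
    define \<psi>' where "\<psi>' = \<psi>(n := - (\<Sum>i<n. ?m (Suc n) i * \<psi> i) / ?m (Suc n) n)"
    have *: "(\<Sum>i<l. ?m l' i * \<psi>' i) = (\<Sum>i<l. ?m l' i * \<psi> i)" if "l \<le> n" for l l'
      using that by (intro sum.cong) (auto simp: \<psi>'_def)
    have "(\<Sum>i<l. ?m l i * \<psi>' i) = 0" if "l \<le> Suc n" for l
    proof (cases "l = Suc n")
      case True
      thus ?thesis using *[of n "Suc n"] n by (simp add: \<psi>'_def)
    next
      case False
      thus ?thesis using * that \<psi>(3)[of l] by (simp add: n_def)
    qed
    moreover have "\<psi>' J = 1" "\<forall>i<J. \<psi>' i = 0" using \<psi> by (auto simp: \<psi>'_def n_def)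
    ultimately show ?case by (intro exI[of _ \<psi>']) (auto simp: n_def)
  qed
  from this[of "k - 1 - Suc J"] J obtain \<psi> where
    \<psi>: "\<psi> J = 1" "\<And>l. l < k \<Longrightarrow> (\<Sum>i<l. ?m l i * \<psi> i) = 0" by force
  \<comment> \<open>No row relation involves coordinate \<open>k - 1\<close>, so the value there is
    free to make the functional kill \<open>v\<close>.\<close>
  define \<psi>' where "\<psi>' = \<psi>(k - 1 := - (\<Sum>i<k-1. fps_nth (v i) 0 * \<psi> i) / fps_nth (v (k - 1)) 0)"
  have "\<psi>' J = 0"
  proof (rule kill)
    show "(\<Sum>i<l. ?m l i * \<psi>' i) = 0" if "l < k" for l
    proof -
      have "(\<Sum>i<l. ?m l i * \<psi>' i) = (\<Sum>i<l. ?m l i * \<psi> i)"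
        using that by (intro sum.cong) (auto simp: \<psi>'_def)
      thus ?thesis using \<psi>(2)[OF that] by simp
    qed
    obtain q where q: "k = Suc q" using J by (cases k) auto
    have "(\<Sum>i<q. fps_nth (v i) 0 * \<psi>' i) = (\<Sum>i<q. fps_nth (v i) 0 * \<psi> i)"
      by (intro sum.cong) (auto simp: \<psi>'_def q)
    thus "(\<Sum>i<k. fps_nth (v i) 0 * \<psi>' i) = 0" using last by (simp add: q \<psi>'_def)
  qed (use J in simp)
  moreover have "J \<noteq> k - 1" using J(1) by auto
  ultimately show False using \<psi>(1) by (simp add: \<psi>'_def)
qed

section \<open>Coefficient equations in \<open>Xi\<close>\<close>

lemma aXi_nth:
  "fps_nth (aXi f l n) (Suc N) = (of_rat l + of_nat N) * fps_nth (f l n) N + fps_nth (f l (Suc n)) N"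
  by (cases N) (simp_all add: aXi_def fps_mult_nth_1 power2_eq_square mult.assoc algebra_simps)

lemma aXi_nth_0: "fps_nth (aXi f l n) 0 = 0"
  by (simp add: aXi_def)

lemma gen_subset_Xi:
  assumes "\<phi> \<in> Xi"
  shows "gen \<phi> \<subseteq> Xi"
proof
  fix f assume "f \<in> gen \<phi>"
  thus "f \<in> Xi"
  proof (induction rule: gen.induct)
    case base
    show ?case by (rule assms)
  next
    case (add f g)
    have "{(l, j). f l j + g l j \<noteq> 0} \<subseteq> {(l, j). f l j \<noteq> 0} \<union> {(l, j). g l j \<noteq> 0}" by auto
    thus ?case using add unfolding Xi_def by (auto intro: finite_subset) (metis add.right_neutral)+
  next
    case (smult f S)
    have "{(l, j). S * f l j \<noteq> 0} \<subseteq> {(l, j). f l j \<noteq> 0}" by auto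
    thus ?case using smult unfolding Xi_def by (auto intro: finite_subset)
  next
    case (aop f)
    have *: "f l j \<noteq> 0 \<or> f l (Suc j) \<noteq> 0" if "aXi f l j \<noteq> 0" for l j
      using that by (auto simp: aXi_def)
    have "{(l, j). aXi f l j \<noteq> 0} \<subseteq> {(l, j). f l j \<noteq> 0} \<union> (\<lambda>(l, j). (l, j - 1)) ` {(l, j). f l j \<noteq> 0}"
      using * by (fastforce simp: image_iff)
    thus ?case using aop * unfolding Xi_def by (auto intro: finite_subset) blast+
  qed
qed

text \<open>Here \<open>s\<close> is indexed by the logarithmic degree. From \<open>j\<close> on it
  is geometric with ratio \<open>- \<alpha>\<close>, and finite support forces it to stop.\<close>

lemma finite_support_recurrence:
  fixes s :: "nat \<Rightarrow> complex"
  assumes "finite {n. s n \<noteq> 0}" "\<And>n. j \<le> n \<Longrightarrow> \<alpha> * s n + s (Suc n) = 0"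
  shows "j < n \<Longrightarrow> s n = 0" and "\<alpha> \<noteq> 0 \<Longrightarrow> j \<le> n \<Longrightarrow> s n = 0"
proof -
  have p: "s (j + m) = (- \<alpha>) ^ m * s j" for m
  proof (induction m)
    case (Suc m)
    have "s (Suc (j + m)) = - \<alpha> * s (j + m)" using assms(2)[of "j + m"] by (simp add: eq_neg_iff_add_eq_0 add.commute)
    thus ?case using Suc by simp
  qed simp
  have sj: "s j = 0" if "\<alpha> \<noteq> 0"
  proof (rule ccontr)
    assume "s j \<noteq> 0"
    hence "range (\<lambda>m. j + m) \<subseteq> {n. s n \<noteq> 0}" using p that by auto
    hence "finite (range (\<lambda>m. j + m))" using assms(1) by (rule finite_subset)
    moreover have "inj (\<lambda>m. j + m)" by (auto intro: injI)
    ultimately show False using finite_imageD[of "\<lambda>m. j + m" UNIV] by simp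
  qed
  show "s n = 0" if "\<alpha> \<noteq> 0" "j \<le> n" using p[of "n - j"] sj that by simp
  show "s n = 0" if "j < n" using p[of "n - j"] sj that by (cases "\<alpha> = 0") auto
qed

lemma xi_sum:
  assumes "\<forall>x\<in>vecs E. \<forall>y\<in>vecs E. g (vadd x y) = (\<lambda>l j. g x l j + g y l j)"
    and "\<forall>S. \<forall>x\<in>vecs E. g (vsmult S x) = (\<lambda>l j. S * g x l j)"
    and "x \<in> vecs E"
  shows "g x l n = (\<Sum>i<rk E. x i * (g (uvec i) l n :: complex fps))"
proof -
  have *: "g (\<lambda>k. if k < m then x k else 0) l n = (\<Sum>i<m. x i * g (uvec i) l n)" if "m \<le> rk E" for m
    using that
  proof (induction m)
    case 0
    have "g (vsmult 0 (\<lambda>_. 0)) l n = 0 * g (\<lambda>_. 0) l n" using assms(2) by (simp add: vecs_def)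
    thus ?case by (simp add: vsmult_def)
  next
    case (Suc m)
    have v: "uvec m \<in> vecs E" "(\<lambda>k. if k < m then x k else 0) \<in> vecs E" "vsmult (x m) (uvec m) \<in> vecs E"
      using Suc.prems by (auto simp: vecs_def uvec_def vsmult_def)
    have e: "(\<lambda>k. if k < Suc m then x k else 0) = vadd (\<lambda>k. if k < m then x k else 0) (vsmult (x m) (uvec m))"
      by (auto simp: vadd_def vsmult_def uvec_def fun_eq_iff less_Suc_eq)
    have "g (\<lambda>k. if k < Suc m then x k else 0) l n = g (\<lambda>k. if k < m then x k else 0) l n + x m * g (uvec m) l n"
      unfolding e using assms(1,2) v by simp
    thus ?case using Suc by simp
  qed
  have "(\<lambda>k. if k < rk E then x k else 0) = x" using assms(3) by (auto simp: vecs_def)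
  thus ?thesis using *[of "rk E"] by simp
qed

lemma sum_lower_row:
  assumes "triangular E ls" "j < rk E"
  shows "(\<Sum>i<rk E. mat E j i * (u i :: complex fps))
    = fps_const (of_rat (ls ! j)) * fps_X * u j + (\<Sum>i<j. mat E j i * u i)"
proof -
  have "(\<Sum>i<rk E. mat E j i * u i) = (\<Sum>i\<in>insert j {..<j}. mat E j i * u i)"
    by (rule sum.mono_neutral_right)
       (use assms in \<open>auto simp: not_less triangularD(3)[OF assms(1)] intro: linorder_cases[of _ j]\<close>)
  thus ?thesis using assms by (simp add: triangularD(2))
qed

lemma rat_class_unique:
  fixes l l0 :: rat
  assumes "0 < l" "l \<le> 1" "0 < l0" "l0 \<le> 1" "l = l0 + of_int n"
  shows "l = l0"
proof -
  have "-1 < (of_int n :: rat)" "(of_int n :: rat) < 1" using assms by linarith+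
  hence "(of_int (-1) :: rat) < of_int n" "(of_int n :: rat) < of_int 1" by simp_all
  hence "n = 0" by (simp only: of_int_less_iff)
  thus ?thesis using assms(5) by simp
qed

text \<open>Triangularity bounds the logarithmic degree of the image \<open>u j\<close> by
  \<open>j\<close> (fact \<open>A\<close>), and injectivity makes the bound sharp (fact
  \<open>C\<close>), since otherwise \<open>u j\<close> would depend linearly on the earlier images.
  The top coefficients then show the pivots.\<close>

lemma theme_imp_pivots:
  assumes tri: "triangular E ls" and th: "theme E"
    and l0: "0 < l0" "l0 \<le> 1" and cl: "\<And>i. i < rk E \<Longrightarrow> \<exists>n::int. ls ! i = l0 + of_int n"
  shows "pivots E ls"
proof -
  define k where "k = rk E"
  obtain \<phi> g where \<phi>: "\<phi> \<in> Xi" and bij: "bij_betw g (vecs E) (gen \<phi>)"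
     and gadd: "\<forall>x\<in>vecs E. \<forall>y\<in>vecs E. g (vadd x y) = (\<lambda>l j. g x l j + g y l j)"
     and gsmult: "\<forall>S. \<forall>x\<in>vecs E. g (vsmult S x) = (\<lambda>l j. S * g x l j)"
     and a: "\<forall>x\<in>vecs E. g (aop E x) = aXi (g x)"
    using th unfolding theme_def by blast
  have uv: "uvec j \<in> vecs E" if "j < k" for j using that by (auto simp: vecs_def uvec_def k_def)
  have av: "aop E x \<in> vecs E" for x by (simp add: vecs_def aop_def)
  obtain v where v: "v \<in> vecs E" "g v = \<phi>"
    using bij gen.base[of \<phi>] by (force simp: bij_betw_def image_iff)
  have "generator E v"
    unfolding generator_def
  proof (intro conjI allI impI v(1))
    fix S assume S: "submod E S" "v \<in> S"
    have Sv: "S \<subseteq> vecs E" using S(1) by (simp add: submod_def)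
    have "f \<in> g ` S" if "f \<in> gen \<phi>" for f
      using that
    proof (induction rule: gen.induct)
      case base
      show ?case using v(2) S(2) by blast
    next
      case (add f h)
      then obtain x y where xy: "x \<in> S" "y \<in> S" "f = g x" "h = g y" by blast
      hence "vadd x y \<in> S" "g (vadd x y) = (\<lambda>l j. f l j + h l j)"
        using S(1) Sv gadd by (auto simp: submod_def subset_iff)
      thus ?case by (metis imageI)
    next
      case (smult f s)
      then obtain x where xy: "x \<in> S" "f = g x" by blast
      hence "vsmult s x \<in> S" "g (vsmult s x) = (\<lambda>l j. s * f l j)"
        using S(1) Sv gsmult by (auto simp: submod_def subset_iff)
      thus ?case by (metis imageI)
    next
      case (aop f)
      then obtain x where xy: "x \<in> S" "f = g x" by blast
      hence "aop E x \<in> S" "g (aop E x) = aXi f" using S(1) Sv a by (auto simp: submod_def)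
      thus ?case by (metis imageI)
    qed
    thus "S = vecs E" using bij Sv by (auto simp: bij_betw_def inj_on_def) blast
  qed
  note unit = generator_imp_subdiagonal_unit[OF tri this]
  define u where "u = (\<lambda>j. g (uvec j))"
  have uXi: "u j \<in> Xi" if "j < k" for j
    using gen_subset_Xi[OF \<phi>] bij uv[OF that] by (auto simp: u_def bij_betw_def)
  have gsum: "g x l n = (\<Sum>i<k. x i * u i l n)" if "x \<in> vecs E" for x l n
    unfolding u_def k_def by (rule xi_sum[OF gadd gsmult that])
  have au: "aXi (u j) l n = fps_const (of_rat (ls ! j)) * fps_X * u j l n + (\<Sum>i<j. mat E j i * u i l n)"
    if "j < k" for j l n
  proof -
    have "aop E (uvec j) i = mat E j i" if "i < k" for i
    proof -
      have "(\<Sum>l<k. uvec j l * mat E l i) = (\<Sum>l<k. if l = j then mat E l i else 0)"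
        by (intro sum.cong) (auto simp: uvec_def)
      thus ?thesis using that \<open>j < k\<close> by (auto simp: aop_def k_def uvec_def)
    qed
    hence "aXi (u j) l n = (\<Sum>i<k. mat E j i * u i l n)"
      using a uv[OF that] gsum[OF av, of "uvec j" l n] by (simp add: u_def)
    thus ?thesis using sum_lower_row[OF tri, of j "\<lambda>i. u i l n"] that by (simp add: k_def)
  qed
  have eq: "(of_rat l + of_nat N - of_rat (ls ! j)) * fps_nth (u j l n) N + fps_nth (u j l (Suc n)) N
     = fps_nth (\<Sum>i<j. mat E j i * u i l n) (Suc N)" if "j < k" for j l n N
    using aXi_nth[of "u j" l n N] by (simp add: au[OF that] algebra_simps)
  have A: "u j l n = 0" if "j < k" "l \<noteq> l0 \<or> j < n" for j l n
    using that
  proof (induction j arbitrary: l n rule: less_induct)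
    case (less j)
    show ?case
    proof (cases "0 < l \<and> l \<le> 1")
      case False
      thus ?thesis using uXi[OF less.prems(1)] by (auto simp: Xi_def)
    next
      case True
      show ?thesis
      proof (rule fps_ext)
        fix N
        define s where "s = (\<lambda>n. fps_nth (u j l n) N)"
        have "finite {(l, n). u j l n \<noteq> 0}" using uXi[OF less.prems(1)] by (simp add: Xi_def)
        hence "finite (snd ` {(l, n). u j l n \<noteq> 0})" by blast
        moreover have "{n. s n \<noteq> 0} \<subseteq> snd ` {(l, n). u j l n \<noteq> 0}"
        proof
          fix n assume "n \<in> {n. s n \<noteq> 0}"
          hence "(l, n) \<in> {(l, n). u j l n \<noteq> 0}" by (auto simp: s_def)
          thus "n \<in> snd ` {(l, n). u j l n \<noteq> 0}" by force
        qed
        ultimately have fin: "finite {n. s n \<noteq> 0}" by (rule finite_subset[rotated])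
        have rec: "(of_rat l + of_nat N - of_rat (ls ! j)) * s n + s (Suc n) = 0" if "l \<noteq> l0 \<or> j \<le> n" for n
        proof -
          have "(\<Sum>i<j. mat E j i * u i l n) = 0"
            using less.IH less.prems(1) that by (intro sum.neutral) auto
          thus ?thesis using eq[OF less.prems(1), of l N n] by (simp add: s_def)
        qed
        show "fps_nth (u j l n) N = fps_nth 0 N"
        proof (cases "l = l0")
          case True
          thus ?thesis using finite_support_recurrence(1)[OF fin rec, of j n] less.prems(2) by (simp add: s_def)
        next
          case False
          \<comment> \<open>Distinct exponents in ]0,1] are incongruent modulo the integers, so away
            from \<open>l0\<close> no degree is resonant and nothing survives.\<close>
          have "of_rat l + of_nat N - (of_rat (ls ! j) :: complex) \<noteq> 0"
          proof
            assume "of_rat l + of_nat N - (of_rat (ls ! j) :: complex) = 0"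
            hence "of_rat (l + of_nat N) = (of_rat (ls ! j) :: complex)" by (simp add: of_rat_add)
            hence "l + of_nat N = ls ! j" by (simp only: of_rat_eq_iff)
            moreover obtain m :: int where "ls ! j = l0 + of_int m" using cl less.prems(1) by (auto simp: k_def)
            ultimately have "l = l0 + of_int (m - int N)" by simp
            thus False using rat_class_unique[of l l0] True l0 False by blast
          qed
          thus ?thesis using finite_support_recurrence(2)[OF fin rec, of 0 n] False by (simp add: s_def)
        qed
      qed
    qed
  qed
  \<comment> \<open>In logarithmic degree \<open>j\<close> the right-hand side is zero, so a
    coefficient can survive only where the diagonal factor vanishes: the top coefficient is a
    monomial.\<close>
  have B: "of_rat l0 + of_nat N = (of_rat (ls ! j) :: complex)" if "j < k" "fps_nth (u j l0 j) N \<noteq> 0" for j N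
  proof -
    have "(\<Sum>i<j. mat E j i * u i l0 j) = 0" using A that(1) by (intro sum.neutral) auto
    thus ?thesis using eq[OF that(1), of l0 N j] A[OF that(1), of l0 "Suc j"] that(2) by simp
  qed
  \<comment> \<open>Elimination of the top logarithmic degree, with the denominators collected in
    \<open>d\<close>.\<close>
  have D: "\<exists>d c. d \<noteq> 0 \<and> (\<forall>l n. d * f l n = (\<Sum>i<m. c i * u i l n))"
    if "m \<le> k" "\<And>i. i < m \<Longrightarrow> u i l0 i \<noteq> 0" "\<And>l n. l \<noteq> l0 \<or> m \<le> n \<Longrightarrow> f l n = 0" for m and f :: xivec
    using that
  proof (induction m arbitrary: f)
    case 0
    thus ?case by (intro exI[of _ 1]) auto
  next
    case (Suc m)
    define f' where "f' = (\<lambda>l n. u m l0 m * f l n - f l0 m * u m l n)"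
    have "f' l n = 0" if "l \<noteq> l0 \<or> m \<le> n" for l n
    proof (cases "l = l0 \<and> n = m")
      case False
      hence "u m l n = 0" "f l n = 0" using that A[of m l n] Suc.prems(1) Suc.prems(3)[of l n] by auto
      thus ?thesis by (simp add: f'_def)
    qed (simp add: f'_def)
    then obtain d c where dc: "d \<noteq> 0" "\<And>l n. d * f' l n = (\<Sum>i<m. c i * u i l n)"
      using Suc.IH[of f'] Suc.prems by force
    have "d * u m l0 m * f l n = (\<Sum>i<Suc m. (c(m := d * f l0 m)) i * u i l n)" for l n
      using dc(2)[of l n] by (simp add: f'_def algebra_simps)
    moreover have "d * u m l0 m \<noteq> 0" using dc(1) Suc.prems(2) by simp
    ultimately show ?case by blast
  qed
  have C: "u j l0 j \<noteq> 0" if "j < k" for j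
    using that
  proof (induction j rule: less_induct)
    case (less j)
    show ?case
    proof
      assume "u j l0 j = 0"
      hence "u j l n = 0" if "l \<noteq> l0 \<or> j \<le> n" for l n
        using that A[OF less.prems, of l n] by (cases "n = j"; cases "l = l0") auto
      then obtain d c where dc: "d \<noteq> 0" "\<And>l n. d * u j l n = (\<Sum>i<j. c i * u i l n)"
        using D[of j "u j"] less by force
      \<comment> \<open>The linear relation between the images, read in \<open>E\<close>: a nonzero
        vector with image zero.\<close>
      define w where "w = (\<lambda>i. if i = j then d else if i < j then - c i else 0)"
      have w: "w \<in> vecs E" "(\<lambda>_. 0) \<in> vecs E" using less.prems by (auto simp: w_def vecs_def k_def)
      have "(\<Sum>i<k. w i * u i l n) = (\<Sum>i\<in>insert j {..<j}. w i * u i l n)" for l n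
        by (rule sum.mono_neutral_right) (use less.prems in \<open>auto simp: w_def\<close>)
      hence "g w = g (\<lambda>_. 0)"
        using dc(2) by (intro ext) (simp add: gsum w, simp add: w_def sum_negf)
      hence "w = (\<lambda>_. 0)" using bij w by (auto simp: bij_betw_def inj_on_def)
      thus False using dc(1) by (auto simp: w_def dest: fun_cong[of _ _ j])
    qed
  qed
  have "\<exists>p. ls ! Suc j - ls ! j + 1 = of_nat p \<and> fps_nth (mat E (Suc j) j) p \<noteq> 0" if j: "Suc j < k" for j
  proof -
    obtain N where N: "fps_nth (u (Suc j) l0 (Suc j)) N \<noteq> 0" using C[OF j] by (auto simp: fps_eq_iff)
    have "(\<Sum>i<Suc j. mat E (Suc j) i * u i l0 j) = mat E (Suc j) j * u j l0 j"
      using A j by (simp add: sum.neutral)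
    \<comment> \<open>By \<open>B\<close> the diagonal factor vanishes in degree \<open>N\<close>,
      so the top coefficient of \<open>u (Suc j)\<close> equals this one.\<close>
    hence "fps_nth (mat E (Suc j) j * u j l0 j) (Suc N) \<noteq> 0"
      using eq[OF j, of l0 N j] N B[OF j N] by simp
    then obtain q where q: "q \<le> Suc N" "fps_nth (mat E (Suc j) j) q \<noteq> 0" "fps_nth (u j l0 j) (Suc N - q) \<noteq> 0"
      unfolding fps_mult_nth by (elim sum.not_neutral_contains_not_neutral) auto
    have "of_rat (l0 + of_nat N) = (of_rat (ls ! Suc j) :: complex)"
      "of_rat (l0 + of_nat (Suc N - q)) = (of_rat (ls ! j) :: complex)"
      using B[OF j N] B[OF _ q(3)] j by (simp_all add: of_rat_add)
    hence "l0 + of_nat N = ls ! Suc j" "l0 + of_nat (Suc N - q) = ls ! j" by (simp_all only: of_rat_eq_iff)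
    hence "ls ! Suc j - ls ! j + 1 = of_nat q" using q(1) by (simp add: of_nat_diff algebra_simps)
    thus ?thesis using q(2) by blast
  qed
  thus ?thesis using unit by (auto simp: pivots_def k_def)
qed

section \<open>Embedding into \<open>\<Xi>\<close>\<close>

text \<open>A vector whose last nonzero coordinate is a unit yields one ending a step earlier, again
  with a unit; together they span everything below.\<close>

lemma submod_contains_lower:
  assumes tri: "triangular E ls" and piv: "pivots E ls" and S: "submod E S"
    and "z \<in> S" "\<And>i. j < i \<Longrightarrow> z i = 0" "fps_nth (z j) 0 \<noteq> 0" "j < rk E"
    and "\<And>i. j < i \<Longrightarrow> x i = 0"
  shows "x \<in> S"
  using assms(4-)
proof (induction j arbitrary: z x)
  case (0 z)
  have "x = vsmult (x 0 * inverse (z 0)) z"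
  proof
    fix i show "x i = vsmult (x 0 * inverse (z 0)) z i"
      using 0 inverse_mult_eq_1[of "z 0"] by (cases i) (auto simp: vsmult_def mult.assoc)
  qed
  thus ?case using S 0(1) by (metis submod_def)
next
  case (Suc j z)
  have lin: "vadd x (vsmult c y) \<in> S" if "x \<in> S" "y \<in> S" for x y c
    using S that by (simp add: submod_def)
  define z' where "z' = vsmult (inverse (z (Suc j))) z"
  have z': "z' \<in> S" "z' (Suc j) = 1" "\<And>i. Suc j < i \<Longrightarrow> z' i = 0"
    using S Suc.prems inverse_mult_eq_1[of "z (Suc j)"] by (auto simp: z'_def submod_def vsmult_def)
  \<comment> \<open>With top coordinate 1, subtracting the diagonal term cancels it exactly. In
    coordinate \<open>j\<close> the constant term left is that of the subdiagonal entry.\<close>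
  define w where "w = vadd (aop E z') (vsmult (- (fps_const (of_rat (ls ! Suc j)) * fps_X)) z')"
  have "w \<in> S" unfolding w_def using S z'(1) by (intro lin) (auto simp: submod_def)
  have a: "aop E z' i = fps_const (of_rat (ls ! i)) * fps_X * z' i
      + (\<Sum>l\<in>{i<..<Suc (Suc j)}. z' l * mat E l i) + fps_X ^ 2 * fps_deriv (z' i)" if "i < rk E" for i
    using aop_triangular(1)[OF tri _ _ that, of "Suc (Suc j)" z'] z'(3) Suc.prems(4) by simp
  have a0: "aop E z' i = 0" if "Suc j < i" for i
    using aop_triangular(2)[OF tri, of "Suc (Suc j)" z' i] z'(3) Suc.prems(4) that by simp
  have "w i = 0" if "j < i" for i
  proof (cases "i = Suc j")
    case True
    moreover have "{Suc j<..<Suc (Suc j)} = {}" by auto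
    ultimately show ?thesis using a[of i] z'(2) Suc.prems(4) by (simp add: w_def vadd_def vsmult_def)
  next
    case False
    thus ?thesis using a0[of i] z'(3) that by (simp add: w_def vadd_def vsmult_def)
  qed
  moreover have "fps_nth (w j) 0 \<noteq> 0"
  proof -
    have "{j<..<Suc (Suc j)} = {Suc j}" by auto
    hence "fps_nth (w j) 0 = fps_nth (mat E (Suc j) j) 0"
      using a[of j] z'(2) Suc.prems(4) by (simp add: w_def vadd_def vsmult_def)
    thus ?thesis using piv Suc.prems(4) by (simp add: pivots_def)
  qed
  ultimately have IH: "y \<in> S" if "\<And>i. j < i \<Longrightarrow> y i = 0" for y
    using Suc.IH[OF \<open>w \<in> S\<close>] Suc.prems(4) that by simp
  have "vadd x (vsmult (- x (Suc j)) z') i = 0" if "j < i" for i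
    using that z'(2) z'(3)[of i] Suc.prems(5)[of i] by (cases "i = Suc j") (auto simp: vadd_def vsmult_def)
  hence "vadd x (vsmult (- x (Suc j)) z') \<in> S" by (rule IH)
  from lin[OF this z'(1), of "x (Suc j)"] show ?case by (simp add: vadd_def vsmult_def)
qed

text \<open>The shift is nilpotent on sequences vanishing from \<open>m\<close> on, so for nonzero
  \<alpha> a finite Neumann series inverts \<alpha> plus the shift. For \<alpha> = 0 the solution is
  \<open>s\<close> moved up one place, which is how the logarithmic degree rises.\<close>

lemma solve_log_recurrence:
  fixes s :: "nat \<Rightarrow> complex"
  assumes "\<And>n. m \<le> n \<Longrightarrow> s n = 0"
  shows "\<exists>t. (\<forall>n. \<alpha> * t n + t (Suc n) = s n) \<and> (\<forall>n>m. t n = 0)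
    \<and> ((\<forall>n. s n = 0) \<longrightarrow> (\<forall>n. t n = 0)) \<and> (\<alpha> = 0 \<longrightarrow> (\<forall>n. t (Suc n) = s n))"
proof (cases "\<alpha> = 0")
  case True
  thus ?thesis using assms
    by (intro exI[of _ "\<lambda>n. case n of 0 \<Rightarrow> 0 | Suc n \<Rightarrow> s n"]) (auto split: nat.splits)
next
  case False
  define t where "t = (\<lambda>n. \<Sum>r<m. s (n + r) * (- 1) ^ r / \<alpha> ^ Suc r)"
  have "\<alpha> * t n + t (Suc n) = s n" for n
  proof -
    define h where "h = (\<lambda>r. s (n + r) * (- 1) ^ r / \<alpha> ^ r)"
    have "\<alpha> * t n = (\<Sum>r<m. h r)" using False by (simp add: t_def h_def sum_distrib_left)
    moreover have "t (Suc n) = - (\<Sum>r<m. h (Suc r))"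
      by (simp add: t_def h_def sum_negf[symmetric])
    moreover have "(\<Sum>r<m. h r - h (Suc r)) = h 0 - h m" by (rule sum_lessThan_telescope')
    ultimately have "\<alpha> * t n + t (Suc n) = h 0 - h m" by (simp add: sum_subtractf)
    thus ?thesis using assms[of "n + m"] by (simp add: h_def)
  qed
  moreover have "t n = 0" if "m < n" for n using assms that by (simp add: t_def)
  moreover have "t n = 0" if "\<forall>n. s n = 0" for n using that by (simp add: t_def)
  ultimately show ?thesis using False by blast
qed

text \<open>One recurrence for each power of \<open>b\<close>. The equation has been divided by
  \<open>b\<close>: the constant coefficients of \<open>f\<close> do not occur, and their vanishing
  has to come from the application.\<close>

lemma solve_log_equation:
  fixes f :: "nat \<Rightarrow> complex fps" and \<beta> :: complex
  assumes "\<forall>n\<ge>m. f n = 0"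
  shows "\<exists>u. (\<forall>n N. (of_nat N - \<beta>) * fps_nth (u n) N + fps_nth (u (Suc n)) N = fps_nth (f n) (Suc N))
    \<and> (\<forall>n>m. u n = 0) \<and> (\<forall>N. (\<forall>n. fps_nth (f n) (Suc N) = 0) \<longrightarrow> (\<forall>n. fps_nth (u n) N = 0))
    \<and> (\<forall>N. of_nat N = \<beta> \<longrightarrow> (\<forall>n. fps_nth (u (Suc n)) N = fps_nth (f n) (Suc N)))"
proof -
  define P where "P = (\<lambda>N t. (\<forall>n. (of_nat N - \<beta>) * t n + t (Suc n) = fps_nth (f n) (Suc N)) \<and> (\<forall>n>m. t n = 0)
    \<and> ((\<forall>n. fps_nth (f n) (Suc N) = 0) \<longrightarrow> (\<forall>n. t n = 0))
    \<and> (of_nat N - \<beta> = 0 \<longrightarrow> (\<forall>n. t (Suc n) = fps_nth (f n) (Suc N))))"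
  have "\<forall>N. \<exists>t. P N t"
    unfolding P_def using assms by (intro allI solve_log_recurrence) simp
  from choice[OF this] obtain t where "\<And>N. P N (t N)" by blast
  thus ?thesis unfolding P_def
    by (intro exI[of _ "\<lambda>n. Abs_fps (\<lambda>N. t N n)"]) (auto simp: fps_eq_iff)
qed

lemma uvec_generates:
  assumes "triangular E ls" "pivots E ls" "submod E S" "uvec (rk E - 1) \<in> S" "1 \<le> rk E"
  shows "S = vecs E"
proof
  show "S \<subseteq> vecs E" using assms(3) by (simp add: submod_def)
  show "vecs E \<subseteq> S"
  proof
    fix x assume "x \<in> vecs E"
    thus "x \<in> S" using assms(5)
      by (intro submod_contains_lower[OF assms(1-4)]) (auto simp: uvec_def vecs_def)
  qed
qed

text \<open>The \<open>j\<close>-th basis vector goes to \<open>u j\<close>, of exact logarithmic degree \<open>j\<close>; one power of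
  \<open>b\<close> is lost at each step, which is why \<open>ls ! 0 > rk E - 1\<close> is needed.\<close>
lemma pivots_imp_embedding:
  assumes tri: "triangular E ls" and piv: "pivots E ls"
    and l0: "l0 \<le> 1" and cl: "ls ! 0 = l0 + of_int n0" and pos: "ls ! 0 > of_nat (rk E) - 1"
  shows "\<exists>u :: nat \<Rightarrow> nat \<Rightarrow> complex fps. \<forall>j<rk E. (\<forall>n>j. u j n = 0) \<and> u j j \<noteq> 0 \<and>
    (\<forall>n. fps_const (of_rat l0) * fps_X * u j n + fps_X * u j (Suc n) + fps_X ^ 2 * fps_deriv (u j n)
       = (\<Sum>i<rk E. mat E j i * u i n))"
proof -
  define k where "k = rk E"
  \<comment> \<open>\<open>N\<close> is the degree of the future top monomial. The bound on
    \<open>ls ! 0\<close> together with \<open>l0 \<le> 1\<close> makes the first one at least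
    \<open>k - 1\<close>, and each step loses at most one because \<open>p\<close> is
    natural.\<close>
  have "\<exists>N. ls ! j = l0 + of_nat N \<and> k \<le> N + j + 1" if "j < k" for j
    using that
  proof (induction j)
    case 0
    have "(of_nat k - 2 :: rat) < of_int n0" using cl pos l0 by (simp add: k_def)
    hence "(of_int (int k - 2) :: rat) < of_int n0" by simp
    hence "int k - 2 < n0" by (simp only: of_int_less_iff)
    thus ?case using cl 0 by (intro exI[of _ "nat n0"]) auto
  next
    case (Suc j)
    then obtain N where N: "ls ! j = l0 + of_nat N" "k \<le> N + j + 1" by auto
    obtain p where p: "ls ! Suc j - ls ! j + 1 = of_nat p" using piv Suc.prems by (auto simp: pivots_def k_def)
    obtain N' where "N = Suc N'" using N(2) Suc.prems by (cases N) auto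
    thus ?case using N p by (intro exI[of _ "N' + p"]) (auto simp: algebra_simps)
  qed
  hence "\<forall>j\<in>{..<k}. \<exists>N. ls ! j = l0 + of_nat N \<and> k \<le> N + j + 1" by auto
  from bchoice[OF this] obtain N where N: "\<And>j. j < k \<Longrightarrow> ls ! j = l0 + of_nat (N j)" "\<And>j. j < k \<Longrightarrow> k \<le> N j + j + 1" by auto
  have res: "of_rat (ls ! j) - of_rat l0 = (of_nat (N j) :: complex)" if "j < k" for j
    using N(1)[OF that] by (simp add: of_rat_add)
  \<comment> \<open>Vanishing below degree \<open>k - 1 - j\<close> is a reserve of powers of
    \<open>b\<close>, of which each division by \<open>b\<close> consumes one.\<close>
  define step where "step = (\<lambda>j (w :: nat \<Rightarrow> complex fps) f. (\<forall>n>j. w n = 0) \<and> fps_nth (w j) (N j) \<noteq> 0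
     \<and> (\<forall>n d. d + j + 1 < k \<longrightarrow> fps_nth (w n) d = 0)
     \<and> (\<forall>n d. (of_nat d - of_nat (N j)) * fps_nth (w n) d + fps_nth (w (Suc n)) d = fps_nth (f n) (Suc d)))"
  define good where "good = (\<lambda>u j. step j (u j) (\<lambda>n. \<Sum>i<j. mat E j i * u i n))"
  have good0: "u j n = 0" if "good u j" "j < n" for u j n
    using that unfolding good_def step_def by blast
  have goodN: "fps_nth (u j j) (N j) \<noteq> 0" if "good u j" for u j
    using that unfolding good_def step_def by blast
  have good_low: "fps_nth (u j n) d = 0" if "good u j" "d + j + 1 < k" for u j n d
    using that unfolding good_def step_def by blast
  have good_eq: "(of_nat d - of_nat (N j)) * fps_nth (u j n) d + fps_nth (u j (Suc n)) d
      = fps_nth (\<Sum>i<j. mat E j i * u i n) (Suc d)" if "good u j" for u j n d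
    using that unfolding good_def step_def by blast
  have supp: "fps_nth (u j j) d = 0" if "\<And>i. i \<le> j \<Longrightarrow> good u i" "d \<noteq> N j" for u j d
  proof -
    have "(\<Sum>i<j. mat E j i * u i j) = 0" by (intro sum.neutral ballI) (simp add: good0[OF that(1)])
    thus ?thesis
      using good_eq[of u j d j] good0[of u j "Suc j"] that(1)[of j] that(2) by simp
  qed
  have "\<exists>u. \<forall>j<m. good u j" if "m \<le> k" for m
    using that
  proof (induction m)
    case (Suc m)
    then obtain u where u: "\<And>j. j < m \<Longrightarrow> good u j" by auto
    have m: "m < k" using Suc.prems by simp
    have ext: "\<exists>u. \<forall>j<Suc m. good u j" if v: "step m v (\<lambda>n. \<Sum>i<m. mat E m i * u i n)" for v
    proof (intro exI[of _ "u(m := v)"] allI impI)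
      fix j assume j: "j < Suc m"
      have "(\<Sum>i<j. mat E j i * (u(m := v)) i n) = (\<Sum>i<j. mat E j i * u i n)" for n
        using j by (intro sum.cong) auto
      thus "good (u(m := v)) j"
        using v u[of j] j unfolding good_def by (cases "j = m") simp_all
    qed
    show ?case
    proof (cases m)
      case 0
      show ?thesis
        \<comment> \<open>The monomial \<open>b^(N 0)\<close> without logarithm solves the
          homogeneous equation.\<close>
        by (rule ext[of "\<lambda>n. if n = 0 then fps_X ^ N 0 else 0"]) (use N(2)[of 0] 0 m in \<open>auto simp: step_def\<close>)
    next
      case (Suc m')
      define f where "f = (\<lambda>n. \<Sum>i<m. mat E m i * u i n)"
      have f0: "f n = 0" if "m \<le> n" for n
        unfolding f_def using that by (intro sum.neutral ballI) (simp add: good0[OF u])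
      have fd: "fps_nth (f n) d = 0" if "d + m < k" for n d
        unfolding f_def fps_sum_nth fps_mult_nth
      proof (intro sum.neutral ballI)
        fix i q assume "i \<in> {..<m}" "q \<in> {0..d}"
        thus "fps_nth (mat E m i) q * fps_nth (u i n) (d - q) = 0"
          using good_low[OF u[of i], of "d - q" n] that by auto
      qed
      have "\<forall>n\<ge>m. f n = 0" using f0 by blast
      from solve_log_equation[of m f "of_nat (N m)", OF this] obtain v where
        "\<forall>n d. (of_nat d - of_nat (N m)) * fps_nth (v n) d + fps_nth (v (Suc n)) d = fps_nth (f n) (Suc d)"
        "\<forall>n>m. v n = 0" "\<forall>d. (\<forall>n. fps_nth (f n) (Suc d) = 0) \<longrightarrow> (\<forall>n. fps_nth (v n) d = 0)"
        "\<forall>d. of_nat d = (of_nat (N m) :: complex) \<longrightarrow> (\<forall>n. fps_nth (v (Suc n)) d = fps_nth (f n) (Suc d))"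
        by (elim exE conjE)
      hence v: "\<And>n d. (of_nat d - of_nat (N m)) * fps_nth (v n) d + fps_nth (v (Suc n)) d = fps_nth (f n) (Suc d)"
        "\<And>n. n > m \<Longrightarrow> v n = 0" "\<And>n d. (\<And>n. fps_nth (f n) (Suc d) = 0) \<Longrightarrow> fps_nth (v n) d = 0"
        "\<And>n. fps_nth (v (Suc n)) (N m) = fps_nth (f n) (Suc (N m))"
        by simp_all
      obtain p where p: "ls ! m - ls ! m' + 1 = of_nat p" "fps_nth (mat E m m') p \<noteq> 0"
        using piv m Suc by (auto simp: pivots_def k_def)
      have Np: "Suc (N m) = p + N m'"
      proof -
        have "rat_of_nat (Suc (N m)) = of_nat (p + N m')" using p(1) N(1)[of m] N(1)[of m'] m Suc by simp
        thus ?thesis by (simp only: of_nat_eq_iff)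
      qed
      have sp: "fps_nth (u m' m') d = 0" if "d \<noteq> N m'" for d
        using supp[of m' u d] u Suc that by simp
      have "f m' = (\<Sum>i\<in>{m'}. mat E m i * u i m')"
        unfolding f_def by (rule sum.mono_neutral_right) (use Suc in \<open>auto simp: good0[OF u]\<close>)
      hence "fps_nth (v m) (N m) = (\<Sum>q\<in>{0..Suc (N m)}. fps_nth (mat E m m') q * fps_nth (u m' m') (Suc (N m) - q))"
        using v(4)[of m'] Suc by (simp add: fps_mult_nth)
      \<comment> \<open>The top coefficient of \<open>u m'\<close> is a monomial of degree
        \<open>N m'\<close>, so of the convolution in degree \<open>p + N m'\<close> only the pivot
        coefficient remains.\<close>
      also have "\<dots> = (\<Sum>q\<in>{p}. fps_nth (mat E m m') q * fps_nth (u m' m') (Suc (N m) - q))"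
        by (rule sum.mono_neutral_right) (use Np Suc in \<open>auto simp: sp\<close>)
      also have "\<dots> \<noteq> 0" using p(2) goodN[OF u[of m']] Suc Np by simp
      finally have vN: "fps_nth (v m) (N m) \<noteq> 0" .
      show ?thesis
      proof (rule ext[of v], unfold step_def, intro conjI allI impI)
        show "fps_nth (v n) d = 0" if "d + m + 1 < k" for n d
          using that by (intro v(3) fd) simp
      qed (use v(1,2) vN in \<open>simp_all add: f_def\<close>)
    qed
  qed simp
  from this[OF order_refl] obtain u where u: "\<And>j. j < k \<Longrightarrow> good u j" by blast
  show ?thesis
    unfolding k_def[symmetric]
  proof (intro exI[of _ u] allI impI conjI)
    fix j n assume j: "j < k"
    show "u j j \<noteq> 0" using goodN[OF u[OF j]] by auto
    show "u j n = 0" if "j < n" using good0[OF u[OF j] that] .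
    have low: "(\<Sum>i<k. mat E j i * u i n) = fps_const (of_rat (ls ! j)) * fps_X * u j n + (\<Sum>i<j. mat E j i * u i n)"
      using sum_lower_row[OF tri, of j "\<lambda>i. u i n"] j by (simp add: k_def)
    show "fps_const (of_rat l0) * fps_X * u j n + fps_X * u j (Suc n) + fps_X ^ 2 * fps_deriv (u j n)
       = (\<Sum>i<k. mat E j i * u i n)" (is "?l = ?r")
    proof (rule fps_ext)
      fix d
      have l: "?l = aXi (\<lambda>_. u j) l0 n" by (simp add: aXi_def)
      show "fps_nth ?l d = fps_nth ?r d"
      proof (cases d)
        case 0
        \<comment> \<open>The degree that the recurrences leave out: the reserve of powers of
          \<open>b\<close> is still positive for every \<open>i < j\<close>.\<close>
        have "fps_nth (u i n) 0 = 0" if "i < j" for i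
          using good_low[OF u[of i], of 0 n] j that by simp
        thus ?thesis unfolding l 0 aXi_nth_0 low by (simp add: fps_sum_nth)
      next
        case (Suc d)
        have "(of_nat d - of_nat (N j)) * fps_nth (u j n) d + fps_nth (u j (Suc n)) d = fps_nth (\<Sum>i<j. mat E j i * u i n) (Suc d)"
          by (rule good_eq[OF u[OF j]])
        thus ?thesis unfolding l Suc aXi_nth low using res[OF j] by (simp add: algebra_simps)
      qed
    qed
  qed
qed

text \<open>The distinct exact logarithmic degrees of the \<open>u j\<close> give injectivity; the
  last basis vector generates \<open>E\<close>, so its image \<phi> generates the whole
  image.\<close>

lemma pivots_imp_theme:
  assumes tri: "triangular E ls" and piv: "pivots E ls" and k1: "1 \<le> rk E"
    and l0: "0 < l0" "l0 \<le> 1" and cl: "ls ! 0 = l0 + of_int n0" and pos: "ls ! 0 > of_nat (rk E) - 1"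
  shows "theme E"
proof -
  define k where "k = rk E"
  obtain u :: "nat \<Rightarrow> nat \<Rightarrow> complex fps" where
    u: "\<And>j n. j < k \<Longrightarrow> j < n \<Longrightarrow> u j n = 0" "\<And>j. j < k \<Longrightarrow> u j j \<noteq> 0"
    and eq: "\<And>j n. j < k \<Longrightarrow> fps_const (of_rat l0) * fps_X * u j n + fps_X * u j (Suc n) + fps_X ^ 2 * fps_deriv (u j n)
       = (\<Sum>i<k. mat E j i * u i n)"
    using pivots_imp_embedding[OF tri piv l0(2) cl pos] unfolding k_def by blast
  define g :: "abvec \<Rightarrow> xivec" where "g = (\<lambda>x l n. if l = l0 then \<Sum>j<k. x j * u j n else 0)"
  define \<phi> where "\<phi> = g (uvec (k - 1))"
  have gadd: "g (vadd x y) = (\<lambda>l j. g x l j + g y l j)" for x y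
    by (auto simp: g_def vadd_def fun_eq_iff distrib_right sum.distrib)
  have gsmult: "g (vsmult S x) = (\<lambda>l j. S * g x l j)" for S x
    by (auto simp: g_def vsmult_def fun_eq_iff sum_distrib_left mult.assoc)
  have ga: "g (aop E x) = aXi (g x)" for x
  proof (intro ext)
    fix l n
    show "g (aop E x) l n = aXi (g x) l n"
    proof (cases "l = l0")
      case True
      have "aXi (g x) l n = (\<Sum>j<k. x j * (fps_const (of_rat l0) * fps_X * u j n + fps_X * u j (Suc n) + fps_X ^ 2 * fps_deriv (u j n)))
          + (\<Sum>j<k. fps_X ^ 2 * fps_deriv (x j) * u j n)"
        by (simp add: True aXi_def g_def fps_deriv_sum sum_distrib_left sum.distrib algebra_simps)
      also have "(\<Sum>j<k. x j * (fps_const (of_rat l0) * fps_X * u j n + fps_X * u j (Suc n) + fps_X ^ 2 * fps_deriv (u j n)))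
         = (\<Sum>j<k. \<Sum>i<k. x j * (mat E j i * u i n))"
        by (intro sum.cong) (simp_all add: eq sum_distrib_left)
      also have "\<dots> = (\<Sum>i<k. (\<Sum>j<k. x j * mat E j i) * u i n)"
        by (subst sum.swap) (simp add: sum_distrib_right mult.assoc)
      finally show ?thesis
        by (simp add: True g_def aop_def k_def sum.distrib distrib_right)
    qed (simp add: g_def aXi_def)
  qed
  have inj: "inj_on g (vecs E)"
  proof (rule inj_onI)
    fix x y assume xy: "x \<in> vecs E" "y \<in> vecs E" "g x = g y"
    have s: "(\<Sum>j<k. (x j - y j) * u j n) = 0" for n
      using fun_cong[OF fun_cong[OF xy(3)], of l0 n] by (simp add: g_def left_diff_distrib sum_subtractf)
    show "x = y"
    proof (rule ccontr)
      assume "x \<noteq> y"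
      then obtain i where i: "x i \<noteq> y i" by auto
      have bd: "i < k" if "x i \<noteq> y i" for i
        using that xy(1,2) unfolding vecs_def k_def by (cases "i < rk E") auto
      define J where "J = (GREATEST i. x i \<noteq> y i)"
      have J: "x J \<noteq> y J" unfolding J_def
        by (rule GreatestI_nat[of "\<lambda>i. x i \<noteq> y i" i k]) (use i bd in \<open>auto intro: less_imp_le\<close>)
      have "i \<le> J" if "x i \<noteq> y i" for i unfolding J_def
        by (rule Greatest_le_nat[of "\<lambda>i. x i \<noteq> y i", OF that, of k]) (rule less_imp_le[OF bd])
      hence Jm: "x i = y i" if "J < i" for i using that leD by blast
      \<comment> \<open>In logarithmic degree \<open>J\<close>, earlier \<open>u j\<close> have no
        term and later coordinates of \<open>x\<close> and \<open>y\<close> agree.\<close>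
      have "(\<Sum>j<k. (x j - y j) * u j J) = (\<Sum>j\<in>{J}. (x j - y j) * u j J)"
      proof (rule sum.mono_neutral_right)
        show "\<forall>i\<in>{..<k} - {J}. (x i - y i) * u i J = 0"
        proof
          fix i assume "i \<in> {..<k} - {J}"
          thus "(x i - y i) * u i J = 0" using Jm[of i] u(1)[of i J] by (cases "i < J") auto
        qed
      qed (use bd[OF J] in auto)
      thus False using s[of J] J u(2)[OF bd[OF J]] by simp
    qed
  qed
  have "gen \<phi> \<subseteq> g ` vecs E"
  proof
    fix f assume "f \<in> gen \<phi>"
    thus "f \<in> g ` vecs E"
    proof (induction rule: gen.induct)
      case base
      show ?case using k1 by (auto simp: \<phi>_def vecs_def uvec_def k_def)
    next
      case (add f h)
      then obtain x y where "x \<in> vecs E" "y \<in> vecs E" "f = g x" "h = g y" by blast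
      hence "vadd x y \<in> vecs E" "g (vadd x y) = (\<lambda>l j. f l j + h l j)" using gadd by (auto simp: vecs_def vadd_def)
      thus ?case by (metis imageI)
    next
      case (smult f S)
      then obtain x where "x \<in> vecs E" "f = g x" by blast
      hence "vsmult S x \<in> vecs E" "g (vsmult S x) = (\<lambda>l j. S * f l j)" using gsmult by (auto simp: vecs_def vsmult_def)
      thus ?case by (metis imageI)
    next
      case (aop f)
      then obtain x where "x \<in> vecs E" "f = g x" by blast
      hence "aop E x \<in> vecs E" "g (aop E x) = aXi f" using ga by (auto simp: vecs_def aop_def)
      thus ?case by (metis imageI)
    qed
  qed
  moreover have "{x \<in> vecs E. g x \<in> gen \<phi>} = vecs E"
  proof (rule uvec_generates[OF tri piv _ _ k1])
    have "g (\<lambda>i. 0) = (\<lambda>l j. 0 * \<phi> l j)" by (auto simp: g_def fun_eq_iff)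
    hence "g (\<lambda>i. 0) \<in> gen \<phi>" using gen.smult[OF gen.base, of 0 \<phi>] by simp
    moreover have "vadd x y \<in> vecs E" if "x \<in> vecs E" "y \<in> vecs E" for x y using that by (auto simp: vecs_def vadd_def)
    moreover have "vsmult S x \<in> vecs E" if "x \<in> vecs E" for x S using that by (auto simp: vecs_def vsmult_def)
    moreover have "aop E x \<in> vecs E" for x by (auto simp: vecs_def aop_def)
    ultimately show "submod E {x \<in> vecs E. g x \<in> gen \<phi>}"
      unfolding submod_def by (auto simp: gadd gsmult ga gen.add gen.smult gen.aop) (auto simp: vecs_def)
    show "uvec (rk E - 1) \<in> {x \<in> vecs E. g x \<in> gen \<phi>}"
      using k1 gen.base[of \<phi>] by (auto simp: \<phi>_def k_def vecs_def uvec_def)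
  qed
  ultimately have "bij_betw g (vecs E) (gen \<phi>)" using inj by (auto simp: bij_betw_def)
  moreover have "\<phi> \<in> Xi"
  proof -
    have "u j n = 0" if "k \<le> n" "j < k" for j n using u(1) that by auto
    hence "g x l n = 0" if "l \<noteq> l0 \<or> k \<le> n" for x l n using that by (auto simp: g_def)
    hence "{(l, j). \<phi> l j \<noteq> 0} \<subseteq> {l0} \<times> {..<k}" unfolding \<phi>_def by (auto simp: not_less[symmetric])
    hence "finite {(l, j). \<phi> l j \<noteq> 0}" by (rule finite_subset) simp
    moreover have "l = l0" if "\<phi> l j \<noteq> 0" for l j using that by (auto simp: \<phi>_def g_def split: if_splits)
    ultimately show ?thesis using l0 by (auto simp: Xi_def)
  qed
  ultimately show ?thesis unfolding theme_def using gadd gsmult ga by blast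
qed

section \<open>Duality\<close>

text \<open>Dualizing transposes the matrix; listing the dual basis backwards makes it lower
  triangular again. The factor \<open>Emod \<delta>\<close> only adds \<delta> b on the
  diagonal.\<close>

definition reversed_dual :: "abmod \<Rightarrow> rat \<Rightarrow> abmod" where
  "reversed_dual T \<delta> = (rk T, \<lambda>i j. (if i = j then fps_const (of_rat \<delta>) * fps_X else 0)
     - mat T (rk T - Suc j) (rk T - Suc i))"

lemma rk_tensor_dual: "rk (tensor (dual E) (Emod \<delta>)) = rk E"
  by (simp add: tensor_def dual_def Emod_def rk_def)

lemma mat_tensor_dual:
  "mat (tensor (dual E) (Emod \<delta>)) i j = - mat E j i + (if i = j then fps_const (of_rat \<delta>) * fps_X else 0)"
  by (simp add: tensor_def dual_def Emod_def rk_def mat_def)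

text \<open>The basis dual to the rows of \<open>X\<close> consists of the columns of
  \<open>C\<close>, taken here backwards. The equation is \<open>base_change_swap\<close>
  transposed: with the minus sign of the dual, the two derivative terms cancel.\<close>

lemma base_change_dual:
  assumes "base_change E T X C"
  shows "base_change (tensor (dual E) (Emod \<delta>)) (reversed_dual T \<delta>)
    (\<lambda>i j. C j (rk E - Suc i)) (\<lambda>i j. X (rk E - Suc j) i)"
proof -
  define k where "k = rk E"
  have rk: "rk T = k" and inv: "inverse_mats k X C" using assms by (auto simp: base_change_def k_def)
  have r: "k - Suc i < k" if "i < k" for i using that by simp
  have req: "k - Suc i = k - Suc j \<longleftrightarrow> i = j" if "i < k" "j < k" for i j using that by auto
  let ?Y = "\<lambda>i j. C j (k - Suc i)" and ?Z = "\<lambda>i j. X (k - Suc j) i"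
  have 1: "mmul k ?Y ?Z i j = (if i = j then 1 else 0)" if "i < k" "j < k" for i j
  proof -
    have "mmul k ?Y ?Z i j = mmul k X C (k - Suc j) (k - Suc i)" by (simp add: mmul_def mult.commute)
    thus ?thesis using inv r req that by (auto simp: inverse_mats_def)
  qed
  have 2: "mmul k ?Z ?Y i j = (if i = j then 1 else 0)" if "i < k" "j < k" for i j
  proof -
    have "mmul k ?Z ?Y i j = (\<Sum>l<k. (\<lambda>l. C j l * X l i) (k - Suc l))" by (simp add: mmul_def mult.commute)
    also have "\<dots> = mmul k C X j i" by (subst sum.nat_diff_reindex) (simp add: mmul_def)
    finally show ?thesis using inv that by (auto simp: inverse_mats_def)
  qed
  have 3: "mmul k ?Y (mat (tensor (dual E) (Emod \<delta>))) i j + fps_X ^ 2 * fps_deriv (?Y i j)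
     = mmul k (mat (reversed_dual T \<delta>)) ?Y i j" if ij: "i < k" "j < k" for i j
  proof -
    define i' where "i' = k - Suc i"
    let ?d = "fps_const (of_rat \<delta>) * fps_X :: complex fps"
    have "mmul k ?Y (mat (tensor (dual E) (Emod \<delta>))) i j
       = (\<Sum>l<k. (if l = j then ?d * C j i' else 0) - mat E j l * C l i')"
      unfolding mmul_def by (intro sum.cong) (auto simp: mat_tensor_dual i'_def algebra_simps)
    also have "\<dots> = ?d * C j i' - mmul k (mat E) C j i'"
      using ij by (simp add: sum_subtractf mmul_def)
    also have "mmul k (mat E) C j i' = mmul k C (mat T) j i' + fps_X ^ 2 * fps_deriv (C j i')"
      using base_change_swap[OF assms, of j i'] r ij by (simp add: k_def i'_def)
    finally have l: "mmul k ?Y (mat (tensor (dual E) (Emod \<delta>))) i j + fps_X ^ 2 * fps_deriv (?Y i j)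
      = ?d * C j i' - mmul k C (mat T) j i'" by (simp add: i'_def)
    have "mmul k (mat (reversed_dual T \<delta>)) ?Y i j
       = (\<Sum>l<k. (if l = i then ?d * C j i' else 0) - (\<lambda>l. C j l * mat T l i') (k - Suc l))"
      unfolding mmul_def by (intro sum.cong) (auto simp: reversed_dual_def mat_def rk i'_def algebra_simps)
    also have "\<dots> = ?d * C j i' - (\<Sum>l<k. (\<lambda>l. C j l * mat T l i') (k - Suc l))"
      using ij by (simp add: sum_subtractf)
    also have "\<dots> = ?d * C j i' - mmul k C (mat T) j i'"
      by (subst sum.nat_diff_reindex) (simp add: mmul_def)
    finally show ?thesis using l by simp
  qed
  show ?thesis
    unfolding base_change_def rk_tensor_dual k_def[symmetric] inverse_mats_def using 1 2 3
    by (auto simp: reversed_dual_def rk_def rk[unfolded rk_def])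
qed

lemma triangular_reversed_dual:
  assumes "triangular T ls"
  shows "triangular (reversed_dual T \<delta>) (map (\<lambda>\<mu>. \<delta> - \<mu>) (rev ls))"
proof -
  have rk: "rk (reversed_dual T \<delta>) = rk T" by (simp add: reversed_dual_def rk_def)
  have m: "mat (reversed_dual T \<delta>) = (\<lambda>i j. (if i = j then fps_const (of_rat \<delta>) * fps_X else 0)
     - mat T (rk T - Suc j) (rk T - Suc i))" by (simp add: reversed_dual_def mat_def)
  show ?thesis unfolding triangular_def rk m
    using triangularD[OF assms]
    by (auto simp: rev_nth of_rat_diff algebra_simps simp flip: fps_const_sub)
qed

lemma pivots_reversed_dual:
  assumes "length ls = rk T" "pivots T ls"
  shows "pivots (reversed_dual T \<delta>) (map (\<lambda>\<mu>. \<delta> - \<mu>) (rev ls))"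
  unfolding pivots_def
proof (intro allI impI)
  fix j assume "Suc j < rk (reversed_dual T \<delta>)"
  hence j: "Suc j < rk T" by (simp add: reversed_dual_def rk_def)
  define i where "i = rk T - Suc (Suc j)"
  have i: "rk T - Suc j = Suc i" "Suc i < rk T" using j by (auto simp: i_def)
  have m: "mat (reversed_dual T \<delta>) (Suc j) j = - mat T (Suc i) i"
    by (simp add: reversed_dual_def mat_def i(1) flip: i_def)
  have "map (\<lambda>\<mu>. \<delta> - \<mu>) (rev ls) ! Suc j - map (\<lambda>\<mu>. \<delta> - \<mu>) (rev ls) ! j = ls ! Suc i - ls ! i"
    using j assms(1) by (simp add: rev_nth i(1) flip: i_def)
  thus "fps_nth (mat (reversed_dual T \<delta>) (Suc j) j) 0 \<noteq> 0 \<and>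
     (\<exists>p. map (\<lambda>\<mu>. \<delta> - \<mu>) (rev ls) ! Suc j - map (\<lambda>\<mu>. \<delta> - \<mu>) (rev ls) ! j + 1 = of_nat p
        \<and> fps_nth (mat (reversed_dual T \<delta>) (Suc j) j) p \<noteq> 0)"
    using assms(2) i(2) unfolding pivots_def m by simp
qed

text \<open>The ceiling minus one, rather than the floor, sends integers to 1, as the half-open
  interval ]0,1] requires.\<close>

lemma rat_class_exists:
  fixes q :: rat
  obtains l0 and n :: int where "0 < l0" "l0 \<le> 1" "q = l0 + of_int n"
proof
  show "0 < q - of_int (\<lceil>q\<rceil> - 1)" "q - of_int (\<lceil>q\<rceil> - 1) \<le> 1" by linarith+
  show "q = q - of_int (\<lceil>q\<rceil> - 1) + of_int (\<lceil>q\<rceil> - 1)" by simp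
qed

theorem theorem3p10:
  fixes E :: abmod and lam \<delta> :: rat and ls :: "rat list"
  assumes "theme E" and "primitive E lam" and "rk E = k" and "1 \<le> k"
    and "fund_invs E ls"
    and "\<delta> > ls ! (k - 1) + of_nat k - 1"
  shows "theme (tensor (dual E) (Emod \<delta>)) \<and> primitive (tensor (dual E) (Emod \<delta>)) (\<delta> - lam)
         \<and> fund_invs (tensor (dual E) (Emod \<delta>)) (map (\<lambda>\<mu>. \<delta> - \<mu>) (rev ls))"
proof -
  let ?D = "tensor (dual E) (Emod \<delta>)" and ?ms = "map (\<lambda>\<mu>. \<delta> - \<mu>) (rev ls)"
  obtain T X C where bc: "base_change E T X C" and tri: "triangular T ls"
    using fund_invs_imp_triangular[OF assms(5)] by blast
  have rk: "rk T = k" using bc assms(3) by (simp add: base_change_def)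
  have len: "length ls = k" using triangularD(1)[OF tri] rk by simp
  have "theme T" by (rule theme_transfer[OF ab_iso_vmap[OF bc] assms(1)])
  have cl: "\<exists>n::int. ls ! i = lam + of_int n" if "i < k" for i
    using primitive_imp_diagonal[OF tri primitive_transfer[OF bc assms(2)]] that rk by simp
  \<comment> \<open>\<open>lam\<close> is any representative of the class; \<open>Xi\<close> needs
    the one in ]0,1].\<close>
  obtain l0 and n :: int where l0: "0 < l0" "l0 \<le> 1" "lam = l0 + of_int n"
    by (rule rat_class_exists)
  have "\<exists>m::int. ls ! i = l0 + of_int m" if i: "i < rk T" for i
  proof -
    obtain m where "ls ! i = lam + of_int m" using cl i rk by auto
    thus ?thesis using l0(3) by (intro exI[of _ "n + m"]) simp
  qed
  from theme_imp_pivots[OF tri \<open>theme T\<close> l0(1,2) this] have piv: "pivots T ls" .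
  define R where "R = reversed_dual T \<delta>"
  have rkR: "rk R = k" by (simp add: R_def reversed_dual_def rk_def rk[unfolded rk_def])
  have bcR: "base_change ?D R (\<lambda>i j. C j (rk E - Suc i)) (\<lambda>i j. X (rk E - Suc j) i)"
    unfolding R_def by (rule base_change_dual[OF bc])
  have triR: "triangular R ?ms" unfolding R_def by (rule triangular_reversed_dual[OF tri])
  have pivR: "pivots R ?ms" unfolding R_def using piv len rk by (intro pivots_reversed_dual) auto
  have ms: "?ms ! i = \<delta> - ls ! (k - Suc i)" if "i < k" for i using that len by (simp add: rev_nth)
  have clR: "\<exists>m::int. ?ms ! i = \<delta> - lam + of_int m" if i: "i < rk R" for i
  proof -
    obtain m where "ls ! (k - Suc i) = lam + of_int m" using cl[of "k - Suc i"] i rkR by auto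
    thus ?thesis using ms i rkR by (intro exI[of _ "- m"]) simp
  qed
  obtain l1 and n1 :: int where l1: "0 < l1" "l1 \<le> 1" "?ms ! 0 = l1 + of_int n1"
    by (rule rat_class_exists)
  have isoR: "ab_iso ?D R (vmap (rk R) (\<lambda>i j. X (rk E - Suc j) i))"
    by (rule ab_iso_vmap[OF base_change_sym[OF bcR]])
  have isoD: "ab_iso R ?D (vmap (rk ?D) (\<lambda>i j. C j (rk E - Suc i)))"
    by (rule ab_iso_vmap[OF bcR])
  \<comment> \<open>The first invariant of the dual is \<open>\<delta> - ls ! (k - 1)\<close>, so
    this is exactly the hypothesis on \<delta>.\<close>
  have "?ms ! 0 > of_nat (rk R) - 1" using ms[of 0] assms(4,6) rkR by simp
  hence "theme R" using pivots_imp_theme[OF triR pivR _ l1] assms(4) rkR by simp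
  hence "theme ?D" by (rule theme_transfer[OF isoR])
  moreover have "primitive ?D (\<delta> - lam)"
    by (rule primitive_transfer[OF base_change_sym[OF bcR] primitive_triangular[OF triR clR]])
  moreover have "fund_invs ?D ?ms"
    by (rule fund_invs_transfer[OF isoD _ fund_invs_triangular[OF triR]])
       (simp add: rkR rk_tensor_dual assms(3))
  ultimately show ?thesis by blast
qed

end
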